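(* Let $T$ be any one of the three sets $\left(-\frac12,-\frac14\right)\cup\left(\frac14,\frac12\right)$, $\left(-\frac14,0\right)\cup\left(\frac14,\frac12\right)$, $\left(-\frac12,-\frac14\right)\cup\left(0,\frac14\right)$. Then $\mathcal{B}(16,7;T)=4320$. Consequently, the code $C_{BW}$ is a tight $T$-avoiding spherical $7$-design for each of these $T$.
   Context: A spherical code is a finite set $C\subset\mathbb{S}^{n-1}$; $I(C)=\{x\cdot y: x,y\in C,\ x\ne y\}$. For $T\subset[-1,1)$, $C$ is $T$-avoiding if $I(C)\cap T=\varnothing$. A spherical $\tau$-design is a spherical code $C$ such that the average over $C$ of every polynomial in $n$ variables of total degree at most $\tau$ equals its average over $\mathbb{S}^{n-1}$ with respect to normalized surface measure. $\mathcal{B}(n,\tau;T)$ is the minimum of $|C|$ over all $T$-avoiding spherical $\tau$-designs $C\subset\mathbb{S}^{n-1}$. Let $P_i^{(n)}$ be the Gegenbauer polynomials: orthogonal on $[-1,1]$ with weight $(1-t^2)^{(n-3)/2}$, $\deg P_i^{(n)}=i$, $P_i^{(n)}(1)=1$; write a real polynomial as $f=\sum_i f_iP_i^{(n)}$. Linear programming gives $\mathcal{B}(n,\tau;T)\ge f(1)/f_0$ for every real polynomial $f$ with $f\ge0$ on $[-1,1]\setminus T$, $f_0>0$, and $f_i\le0$ for all $i\ge\tau+1$. A $T$-avoiding spherical $\tau$-design $C\subset\mathbb{S}^{n-1}$ is called tight if $|C|=f(1)/f_0$ for some such $f$. $C_{BW}\subset\mathbb{S}^{15}$ is the kissing configuration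 of the Barnes--Wall lattice in $\mathbb{R}^{16}$, i.e. its $4320$ minimal vectors rescaled to unit length. It is an antipodal spherical $7$-design with inner products $-1,\pm\frac12,\pm\frac14,0$. *)

theory Defs
  imports "HOL-Analysis.Analysis" "HOL-Computational_Algebra.Polynomial" "HOL-Library.Z2"
begin

section \<open>Spherical codes and designs\<close>

definition spherical_code :: "(real ^ 'n) set \<Rightarrow> bool" where
  "spherical_code C \<longleftrightarrow> finite C \<and> C \<subseteq> sphere 0 1"

definition inner_products :: "(real ^ 'n) set \<Rightarrow> real set" where
  "inner_products C = {x \<bullet> y | x y. x \<in> C \<and> y \<in> C \<and> x \<noteq> y}"

definition avoiding :: "real set \<Rightarrow> (real ^ 'n) set \<Rightarrow> bool" where
  "avoiding T C \<longleftrightarrow> inner_products C \<inter> T = {}"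

text \<open>
  The surface measure of a Borel set \<open>A\<close> of the unit sphere is proportional to the volume of the
  cone \<open>{r *\<^sub>R x | r x. 0 < r \<and> r < 1 \<and> x \<in> A}\<close>. The normalized surface measure is thus the
  image of the uniform distribution on the unit ball under radial projection. It is given as a
  measure on the whole space; the unit sphere has full measure, since only the origin is not
  projected into it.
\<close>

definition normalized_surface_measure :: "(real ^ 'n) measure" where
  "normalized_surface_measure =
     distr (uniform_measure lborel (ball 0 1)) borel (\<lambda>x. x /\<^sub>R norm x)"

text \<open>Multivariate polynomials are represented by the functions they induce; \<open>\<alpha>\<close> ranges over the
  exponent vectors of the monomials that occur.\<close>

definition polynomial_of_total_degree_le :: "nat \<Rightarrow> (real ^ 'n \<Rightarrow> real) \<Rightarrow> bool" where
  "polynomial_of_total_degree_le d p \<longleftrightarrow>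
     (\<exists>(A :: ('n \<Rightarrow> nat) set) (c :: ('n \<Rightarrow> nat) \<Rightarrow> real).
        finite A \<and> (\<forall>\<alpha>\<in>A. (\<Sum>i\<in>UNIV. \<alpha> i) \<le> d) \<and>
        p = (\<lambda>x. \<Sum>\<alpha>\<in>A. c \<alpha> * (\<Prod>i\<in>UNIV. (x $ i) ^ \<alpha> i)))"

definition spherical_design :: "nat \<Rightarrow> (real ^ 'n) set \<Rightarrow> bool" where
  "spherical_design \<tau> C \<longleftrightarrow>
     spherical_code C \<and> C \<noteq> {} \<and>
     (\<forall>p. polynomial_of_total_degree_le \<tau> p \<longrightarrow>
        (\<Sum>x\<in>C. p x) / real (card C) = (\<integral>x. p x \<partial>normalized_surface_measure))"

text \<open>
  \<open>min_design_size TYPE('n) \<tau> T\<close> is \<open>\<B>(CARD('n), \<tau>; T)\<close>. The infimum of a nonempty set of natural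
  numbers is its minimum; the value is 0 if there is no \<open>T\<close>-avoiding spherical \<open>\<tau>\<close>-design.
\<close>

definition min_design_size :: "'n::finite itself \<Rightarrow> nat \<Rightarrow> real set \<Rightarrow> nat" where
  "min_design_size _ \<tau> T =
     Inf {card C | C :: (real ^ 'n) set. spherical_design \<tau> C \<and> avoiding T C}"


section \<open>Gegenbauer polynomials and tightness\<close>

definition is_gegenbauer_family :: "nat \<Rightarrow> (nat \<Rightarrow> real poly) \<Rightarrow> bool" where
  "is_gegenbauer_family n P \<longleftrightarrow>
     (\<forall>i. degree (P i) = i \<and> poly (P i) 1 = 1) \<and>
     (\<forall>i j. i \<noteq> j \<longrightarrow>
        (LBINT t:{-1..1}. poly (P i) t * poly (P j) t * (1 - t\<^sup>2) powr ((real n - 3) / 2)) = 0)"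

text \<open>Well defined for \<open>n \<ge> 2\<close>, where the weight is integrable.\<close>

definition gegenbauer :: "nat \<Rightarrow> nat \<Rightarrow> real poly" where
  "gegenbauer n = (THE P. is_gegenbauer_family n P)"

text \<open>\<open>c\<close> is the (unique) sequence of coefficients of \<open>f\<close> in the Gegenbauer basis.\<close>

definition gegenbauer_expansion :: "nat \<Rightarrow> real poly \<Rightarrow> (nat \<Rightarrow> real) \<Rightarrow> bool" where
  "gegenbauer_expansion n f c \<longleftrightarrow>
     (\<forall>i>degree f. c i = 0) \<and> f = (\<Sum>i\<le>degree f. smult (c i) (gegenbauer n i))"

definition tight_avoiding_design :: "nat \<Rightarrow> real set \<Rightarrow> (real ^ 'n) set \<Rightarrow> bool" where
  "tight_avoiding_design \<tau> T C \<longleftrightarrow>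
     spherical_design \<tau> C \<and> avoiding T C \<and>
     (\<exists>f c. gegenbauer_expansion CARD('n) f c \<and>
        (\<forall>t\<in>{-1..1} - T. poly f t \<ge> 0) \<and> c 0 > 0 \<and> (\<forall>i\<ge>\<tau> + 1. c i \<le> 0) \<and>
        real (card C) = poly f 1 / c 0)"


section \<open>The Barnes--Wall configuration\<close>

text \<open>
  The first-order Reed--Muller code of length 16: evaluations of affine functions on the binary
  vectors of length 4. Coordinate \<open>of_nat k\<close> corresponds to the vector of binary digits of \<open>k < 16\<close>.
\<close>

definition reed_muller_1_4 :: "(bit ^ 16) set" where
  "reed_muller_1_4 =
     {u. \<exists>(b :: bit) (a :: nat \<Rightarrow> bit). \<forall>k<16.
        u $ of_nat k = b + (\<Sum>j<4. a j * of_bool (bit (k :: nat) j))}"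

text \<open>
  The Barnes--Wall lattice, obtained by applying Construction B of Conway and Sloane (\<^emph>\<open>Sphere
  Packings, Lattices and Groups\<close>) to this code, with their scaling (minimal norm \<open>v \<bullet> v = 4\<close>).
\<close>

definition barnes_wall_lattice :: "(real ^ 16) set" where
  "barnes_wall_lattice =
     {(1 / sqrt 2) *\<^sub>R (\<chi> i. of_int (z $ i)) | z :: int ^ 16.
        (\<chi> i. of_int (z $ i)) \<in> reed_muller_1_4 \<and> 4 dvd (\<Sum>i\<in>UNIV. z $ i)}"

definition minimal_vectors :: "(real ^ 'n) set \<Rightarrow> (real ^ 'n) set" where
  "minimal_vectors L = {v \<in> L. v \<noteq> 0 \<and> (\<forall>w\<in>L. w \<noteq> 0 \<longrightarrow> norm v \<le> norm w)}"

definition C_BW :: "(real ^ 16) set" where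
  "C_BW = (\<lambda>v. v /\<^sub>R norm v) ` minimal_vectors barnes_wall_lattice"

end

theory Submission
  imports Defs "HOL-Probability.Probability_Measure"
begin

text \<open>
  For each \<open>T\<close> there is a polynomial \<open>f\<close> of degree 7 that is nonnegative on \<open>[-1, 1] - T\<close> and vanishes
  at every inner product of \<open>C_BW\<close>; since its degree does not exceed the strength of the
  design, linear programming gives the bound \<open>f(1) / f\<^sub>0 = 4320\<close>, where \<open>f\<^sub>0\<close> is the average of
  \<open>f (x \<bullet> y)\<close> over \<open>x\<close> in the sphere. The same moments \<open>f\<^sub>0\<close> come out of the Gegenbauer weight.

  That \<open>C_BW\<close> is a 7-design reduces, by polarization, to the power sums of \<open>v \<bullet> y\<close> over the minimal
  vectors \<open>v\<close>. These vectors are all sign patterns on pairs of coordinates and the even sign patterns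
  on the supports of the 30 Reed--Muller codewords of weight 8. Even sign patterns on 8 coordinates
  have the same moments of order below 8 as all sign patterns, and the sums over the codewords follow
  from Parseval's identity for the Walsh transform.
\<close>

section \<open>Moments of linear forms determine a polynomial average\<close>

text \<open>The three sets \<open>T\<close> come from counting zeros. A polynomial of degree 7
  vanishing at all six inner products has one zero to spare. The zero at -1 lies on the boundary of
  [-1, 1] and may be simple. If one of the five others is doubled, the remaining four, paired in
  increasing order, bound the intervals where the polynomial is negative. Doubling 0, -1/2 or 1/2
  gives the three sets; doubling -1/4 or 1/4 would put that inner product inside an interval. For
  \<open>degree f \<le> 7\<close> the bound follows from the design property alone. Gegenbauer
  polynomials enter through tightness, which is phrased in terms of \<open>c 0\<close>; since
  \<open>gegenbauer\<close> is a definite description, existence and uniqueness of the orthogonal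
  family come before the identification of \<open>c 0\<close> with the surface average. Moments are
  found from recursions, on the sphere by rotation invariance and the unit norm, on the interval by
  integration by parts. The two recursions agree, and \<open>sphere_moment\<close> is their common
  solution.\<close>

lemma real_polynomial_function_inner_left [intro]:
  "real_polynomial_function (\<lambda>x. x \<bullet> y)"
  by (intro real_polynomial_function.intros(1) bounded_linear_inner_left)

lemma real_polynomial_function_vec_nth [intro]: "real_polynomial_function (\<lambda>x. x $ i)"
  by (rule real_polynomial_function.intros(1)) (rule bounded_linear_vec_nth)

text \<open>Linearity is demanded on polynomial functions only, because the integral is not additive
  on arbitrary functions. The two instances are the surface average and, for the design criterion,
  the difference between the average over a finite set and the surface average.\<close>

locale polynomial_functional =
  fixes \<Lambda> :: "('a::real_inner \<Rightarrow> real) \<Rightarrow> real"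
  assumes add: "\<And>f g. real_polynomial_function f \<Longrightarrow> real_polynomial_function g \<Longrightarrow>
      \<Lambda> (\<lambda>x. f x + g x) = \<Lambda> f + \<Lambda> g"
    and scale: "\<And>c f. real_polynomial_function f \<Longrightarrow> \<Lambda> (\<lambda>x. c * f x) = c * \<Lambda> f"
begin

lemma zero: "\<Lambda> (\<lambda>x. 0) = 0"
  using scale[of "\<lambda>x. 0" 0] by (simp add: real_polynomial_function.intros(2))

lemma sum:
  assumes "finite J" "\<And>j. j \<in> J \<Longrightarrow> real_polynomial_function (f j)"
  shows "\<Lambda> (\<lambda>x. \<Sum>j\<in>J. f j x) = (\<Sum>j\<in>J. \<Lambda> (f j))"
  using assms
  by (induction J rule: finite_induct) (auto simp: zero add real_polynomial_function_sum)

text \<open>By the binomial theorem the differentiated function is a polynomial in \<open>s\<close>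
  whose linear coefficient is the claimed derivative, so linearity of \<open>\<Lambda>\<close>
  replaces differentiation under an integral sign.\<close>

lemma deriv_direction:
  assumes q: "real_polynomial_function q"
  shows "((\<lambda>s. \<Lambda> (\<lambda>x. q x * (x \<bullet> (y + s *\<^sub>R z)) ^ Suc k)) has_real_derivative
           real (Suc k) * \<Lambda> (\<lambda>x. q x * (x \<bullet> z) * (x \<bullet> y) ^ k)) (at 0)"
proof -
  define a where
    "a j = real (Suc k choose j) * \<Lambda> (\<lambda>x. q x * (x \<bullet> z) ^ j * (x \<bullet> y) ^ (Suc k - j))" for j
  have poly: "real_polynomial_function (\<lambda>x. q x * (x \<bullet> z) ^ j * (x \<bullet> y) ^ (Suc k - j))" for j
    by (intro real_polynomial_function.intros(4) real_polynomial_function_power q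
        real_polynomial_function_inner_left)
  have expand: "\<Lambda> (\<lambda>x. q x * (x \<bullet> (y + s *\<^sub>R z)) ^ Suc k) = (\<Sum>j\<le>Suc k. a j * s ^ j)" for s
  proof -
    have "q x * (x \<bullet> (y + s *\<^sub>R z)) ^ Suc k =
        (\<Sum>j\<le>Suc k. (real (Suc k choose j) * s ^ j) * (q x * (x \<bullet> z) ^ j * (x \<bullet> y) ^ (Suc k - j)))"
      for x
    proof -
      have "(x \<bullet> (y + s *\<^sub>R z)) ^ Suc k = (s * (x \<bullet> z) + x \<bullet> y) ^ Suc k"
        by (simp add: inner_simps add.commute)
      also have "\<dots> = (\<Sum>j\<le>Suc k. of_nat (Suc k choose j) * (s * (x \<bullet> z)) ^ j * (x \<bullet> y) ^ (Suc k - j))"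
        by (rule binomial_ring)
      finally show ?thesis
        by (simp add: sum_distrib_left power_mult_distrib mult_ac del: power_Suc sum.atMost_Suc)
    qed
    then have "\<Lambda> (\<lambda>x. q x * (x \<bullet> (y + s *\<^sub>R z)) ^ Suc k) =
        (\<Sum>j\<le>Suc k. (real (Suc k choose j) * s ^ j) * \<Lambda> (\<lambda>x. q x * (x \<bullet> z) ^ j * (x \<bullet> y) ^ (Suc k - j)))"
      by (simp only: sum[OF finite_atMost] scale poly real_polynomial_function.intros(4)
          real_polynomial_function.intros(2))
    then show ?thesis
      by (simp add: a_def mult_ac del: sum.atMost_Suc)
  qed
  have "((\<lambda>s. \<Sum>j\<le>Suc k. a j * s ^ j) has_real_derivative
      (\<Sum>j\<le>Suc k. a j * (real j * 0 ^ (j - 1)))) (at 0)"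
    by (rule DERIV_sum) (auto intro!: derivative_eq_intros)
  \<comment> \<open>At \<open>s = 0\<close> only \<open>j = 1\<close> survives: for
    \<open>j = 0\<close> the truncated exponent gives \<open>0 ^ 0 = 1\<close>, but the factor
    \<open>real j\<close> is 0.\<close>
  also have "(\<Sum>j\<le>Suc k. a j * (real j * 0 ^ (j - 1))) = (\<Sum>j\<in>{1}. a j * (real j * 0 ^ (j - 1)))"
    by (rule sum.mono_neutral_right) (auto simp: power_0_left)
  also have "\<dots> = real (Suc k) * \<Lambda> (\<lambda>x. q x * (x \<bullet> z) * (x \<bullet> y) ^ k)"
    by (simp add: a_def)
  finally show ?thesis
    unfolding expand .
qed

text \<open>Polarization: the derivative in direction \<open>z\<close> replaces one factor \<open>x \<bullet> y\<close> by \<open>x \<bullet> z\<close>.\<close>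

lemma polarization:
  assumes "real_polynomial_function q" "\<And>y. \<Lambda> (\<lambda>x. q x * (x \<bullet> y) ^ length zs) = 0"
  shows "\<Lambda> (\<lambda>x. q x * (\<Prod>z\<leftarrow>zs. x \<bullet> z)) = 0"
  using assms
\<comment> \<open>Factors \<open>x \<bullet> z\<close> already split off are absorbed into
  \<open>q\<close>, hence its generalization.\<close>
proof (induction zs arbitrary: q)
  case Nil
  then show ?case by simp
next
  case (Cons z zs)
  have "\<Lambda> (\<lambda>x. q x * (x \<bullet> z) * (x \<bullet> y) ^ length zs) = 0" for y
  proof -
    have "((\<lambda>s. 0) has_real_derivative
        real (Suc (length zs)) * \<Lambda> (\<lambda>x. q x * (x \<bullet> z) * (x \<bullet> y) ^ length zs)) (at 0)"
      using deriv_direction[OF Cons.prems(1), of y z "length zs"] Cons.prems(2)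
      by (simp del: power_Suc)
    from DERIV_unique[OF this DERIV_const] show ?thesis
      by simp
  qed
  from Cons.IH[OF real_polynomial_function.intros(4)[OF Cons.prems(1)] this] show ?case
    by (auto simp: mult_ac)
qed

end

text \<open>Brings a monomial into the form that \<open>polarization\<close> handles: the vector
  \<open>axis i 1\<close> is repeated \<open>\<alpha> i\<close> times.\<close>

lemma monomial_eq_prod_list_inner:
  fixes \<alpha> :: "'n::finite \<Rightarrow> nat"
  obtains zs :: "(real ^ 'n) list" where "length zs = (\<Sum>i\<in>UNIV. \<alpha> i)"
    "\<And>x. (\<Prod>i\<in>UNIV. (x $ i) ^ \<alpha> i) = (\<Prod>z\<leftarrow>zs. x \<bullet> z)"
proof -
  have "\<exists>zs :: (real ^ 'n) list. length zs = (\<Sum>i\<in>I. \<alpha> i) \<and>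
      (\<forall>x. (\<Prod>i\<in>I. (x $ i) ^ \<alpha> i) = (\<Prod>z\<leftarrow>zs. x \<bullet> z))" if "finite I" for I
    using that
  proof (induction I rule: finite_induct)
    case (insert i I)
    then obtain zs :: "(real ^ 'n) list" where zs: "length zs = (\<Sum>i\<in>I. \<alpha> i)"
      "\<forall>x. (\<Prod>i\<in>I. (x $ i) ^ \<alpha> i) = (\<Prod>z\<leftarrow>zs. x \<bullet> z)"
      by blast
    then show ?case
      using insert.hyps
      by (intro exI[of _ "replicate (\<alpha> i) (axis i 1) @ zs"])
         (simp add: inner_axis prod_list_replicate)
  qed simp
  from this[of UNIV] that show thesis
    by auto
qed

text \<open>This is the Laplacian in \<open>y\<close> applied to both sides of \<open>h\<close>: two
  derivatives in a direction \<open>e\<close>, summed over the orthonormal set \<open>E\<close>. On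
  the left the sum of \<open>(x \<bullet> e)\<^sup>2\<close> is \<open>x \<bullet> x\<close>, which
  \<open>unit\<close> removes; on the right the Laplacian of \<open>(y \<bullet> y) ^ Suc l\<close>
  produces the factor \<open>card E + 2 * l\<close>.\<close>

lemma (in polynomial_functional) moment_recursion:
  fixes y :: 'a and E :: "'a set"
  assumes "finite E" and E: "\<And>v. (\<Sum>e\<in>E. (v \<bullet> e)\<^sup>2) = v \<bullet> v" "\<And>e. e \<in> E \<Longrightarrow> e \<bullet> e = 1"
    and h: "\<And>y. \<Lambda> (\<lambda>x. (x \<bullet> y) ^ (2 * Suc l)) = c * (y \<bullet> y) ^ Suc l"
    and unit: "\<And>y. \<Lambda> (\<lambda>x. (x \<bullet> x) * (x \<bullet> y) ^ (2 * l)) = \<Lambda> (\<lambda>x. (x \<bullet> y) ^ (2 * l))"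
  shows "(2 * real l + 1) * \<Lambda> (\<lambda>x. (x \<bullet> y) ^ (2 * l)) = c * (real (card E) + 2 * real l) * (y \<bullet> y) ^ l"
proof -
  have 1: "\<Lambda> (\<lambda>x. (x \<bullet> z) * (x \<bullet> y) ^ Suc (2 * l)) = c * (y \<bullet> z) * (y \<bullet> y) ^ l" for y z
  proof -
    have "((\<lambda>s. \<Lambda> (\<lambda>x. 1 * (x \<bullet> (y + s *\<^sub>R z)) ^ Suc (2 * l + 1))) has_real_derivative
           real (Suc (2 * l + 1)) * \<Lambda> (\<lambda>x. 1 * (x \<bullet> z) * (x \<bullet> y) ^ (2 * l + 1))) (at 0)"
      by (rule deriv_direction) (rule real_polynomial_function.intros(2))
    moreover have "\<Lambda> (\<lambda>x. 1 * (x \<bullet> (y + s *\<^sub>R z)) ^ Suc (2 * l + 1)) =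
        c * (y \<bullet> y + 2 * s * (y \<bullet> z) + s\<^sup>2 * (z \<bullet> z)) ^ Suc l" for s
      using h[of "y + s *\<^sub>R z"]
      by (simp add: inner_simps inner_commute power2_eq_square algebra_simps del: power_Suc)
    ultimately have d1: "((\<lambda>s. c * (y \<bullet> y + 2 * s * (y \<bullet> z) + s\<^sup>2 * (z \<bullet> z)) ^ Suc l) has_real_derivative
           real (2 * l + 2) * \<Lambda> (\<lambda>x. (x \<bullet> z) * (x \<bullet> y) ^ Suc (2 * l))) (at 0)"
      by (simp del: power_Suc)
    have d2: "((\<lambda>s. c * (y \<bullet> y + 2 * s * (y \<bullet> z) + s\<^sup>2 * (z \<bullet> z)) ^ Suc l) has_real_derivative
        c * (real (Suc l) * (2 * (y \<bullet> z)) * (y \<bullet> y) ^ l)) (at 0)"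
      by (auto intro!: derivative_eq_intros simp del: power_Suc)
    have "real (2 * l + 2) * \<Lambda> (\<lambda>x. (x \<bullet> z) * (x \<bullet> y) ^ Suc (2 * l)) =
        real (2 * l + 2) * (c * (y \<bullet> z) * (y \<bullet> y) ^ l)"
      using DERIV_unique[OF d1 d2] by (simp add: algebra_simps)
    then show ?thesis
      by (subst (asm) mult_cancel_left) auto
  qed
  \<comment> \<open>The second derivative in direction \<open>z\<close>. For \<open>l = 0\<close>
    the exponent \<open>l - 1\<close> is truncated to 0, and the factor \<open>real l\<close>
    removes the term.\<close>
  have 2: "real (2 * l + 1) * \<Lambda> (\<lambda>x. (x \<bullet> z)\<^sup>2 * (x \<bullet> y) ^ (2 * l)) =
      c * ((z \<bullet> z) * (y \<bullet> y) ^ l + 2 * real l * (y \<bullet> z)\<^sup>2 * (y \<bullet> y) ^ (l - 1))" for z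
  proof -
    have "((\<lambda>s. \<Lambda> (\<lambda>x. (x \<bullet> z) * (x \<bullet> (y + s *\<^sub>R z)) ^ Suc (2 * l))) has_real_derivative
           real (Suc (2 * l)) * \<Lambda> (\<lambda>x. (x \<bullet> z) * (x \<bullet> z) * (x \<bullet> y) ^ (2 * l))) (at 0)"
      by (rule deriv_direction) auto
    moreover have "\<Lambda> (\<lambda>x. (x \<bullet> z) * (x \<bullet> (y + s *\<^sub>R z)) ^ Suc (2 * l)) =
        c * (y \<bullet> z + s * (z \<bullet> z)) * (y \<bullet> y + 2 * s * (y \<bullet> z) + s\<^sup>2 * (z \<bullet> z)) ^ l" for s
      unfolding 1
      by (simp add: inner_simps inner_commute power2_eq_square algebra_simps)
    ultimately have d1: "((\<lambda>s. c * (y \<bullet> z + s * (z \<bullet> z)) * (y \<bullet> y + 2 * s * (y \<bullet> z) + s\<^sup>2 * (z \<bullet> z)) ^ l)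
        has_real_derivative real (2 * l + 1) * \<Lambda> (\<lambda>x. (x \<bullet> z)\<^sup>2 * (x \<bullet> y) ^ (2 * l))) (at 0)"
      by (simp add: power2_eq_square)
    have d2: "((\<lambda>s. c * (y \<bullet> z + s * (z \<bullet> z)) * (y \<bullet> y + 2 * s * (y \<bullet> z) + s\<^sup>2 * (z \<bullet> z)) ^ l)
        has_real_derivative c * ((z \<bullet> z) * (y \<bullet> y) ^ l + 2 * real l * (y \<bullet> z)\<^sup>2 * (y \<bullet> y) ^ (l - 1))) (at 0)"
      by (auto intro!: derivative_eq_intros simp: algebra_simps power2_eq_square)
    from DERIV_unique[OF d1 d2] show ?thesis .
  qed
  have "real (2 * l + 1) * \<Lambda> (\<lambda>x. (x \<bullet> y) ^ (2 * l)) =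
      (\<Sum>e\<in>E. real (2 * l + 1) * \<Lambda> (\<lambda>x. (x \<bullet> e)\<^sup>2 * (x \<bullet> y) ^ (2 * l)))"
  proof -
    have "\<Lambda> (\<lambda>x. (x \<bullet> y) ^ (2 * l)) = \<Lambda> (\<lambda>x. \<Sum>e\<in>E. (x \<bullet> e)\<^sup>2 * (x \<bullet> y) ^ (2 * l))"
      by (simp add: E(1) sum_distrib_right[symmetric] unit)
    also have "\<dots> = (\<Sum>e\<in>E. \<Lambda> (\<lambda>x. (x \<bullet> e)\<^sup>2 * (x \<bullet> y) ^ (2 * l)))"
      by (intro sum[OF \<open>finite E\<close>] real_polynomial_function.intros(4) real_polynomial_function_power
          real_polynomial_function_inner_left)
    finally show ?thesis
      by (simp add: sum_distrib_left)
  qed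
  also have "\<dots> = (\<Sum>e\<in>E. c * (y \<bullet> y) ^ l + c * 2 * real l * (y \<bullet> y) ^ (l - 1) * (y \<bullet> e)\<^sup>2)"
    unfolding 2 using E(2) by (intro sum.cong) (auto simp: algebra_simps)
  also have "\<dots> = real (card E) * (c * (y \<bullet> y) ^ l) + c * 2 * real l * (y \<bullet> y) ^ (l - 1) * (y \<bullet> y)"
    by (simp add: sum.distrib sum_distrib_left[symmetric] E(1))
  also have "\<dots> = c * (real (card E) + 2 * real l) * (y \<bullet> y) ^ l"
    by (cases l) (auto simp: algebra_simps)
  finally show ?thesis
    by (simp add: add.commute)
qed

section \<open>Surface averages\<close>

text \<open>It suffices to compare the measures on boxes. The preimage of a box is its image under
  the inverse, which is again orthogonal and so preserves Lebesgue measure.\<close>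

lemma lborel_distr_orthogonal_transformation:
  fixes f :: "real ^ 'n::{finite,wellorder} \<Rightarrow> real ^ 'n::_"
  assumes f: "orthogonal_transformation f"
  shows "distr lborel borel f = lborel"
proof (rule lborel_eqI[symmetric])
  fix l u :: "real ^ 'n::_"
  assume le: "\<And>b. b \<in> Basis \<Longrightarrow> l \<bullet> b \<le> u \<bullet> b"
  from f have lin: "linear f" and "bij f"
    by (auto simp: orthogonal_transformation_linear orthogonal_transformation_bij)
  have [measurable]: "f \<in> borel_measurable borel"
    by (intro borel_measurable_continuous_onI linear_continuous_on
        linear_conv_bounded_linear[THEN iffD1] lin)
  have g: "orthogonal_transformation (inv f)"
    by (rule orthogonal_transformation_inv[OF f])
  have vimage: "f -` box l u = inv f ` box l u"
    by (rule bij_vimage_eq_inv_image[OF \<open>bij f\<close>])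
  have "emeasure (distr lborel borel f) (box l u) = emeasure lborel (f -` box l u)"
    by (simp add: emeasure_distr)
  also have "\<dots> = emeasure lebesgue (inv f ` box l u)"
    using measurable_sets_borel[of f borel "box l u"] by (simp add: vimage)
  also have "\<dots> = ennreal (measure lebesgue (inv f ` box l u))"
    by (intro emeasure_eq_measure2 measurable_orthogonal_image[OF g]) auto
  also have "\<dots> = ennreal (measure lebesgue (box l u))"
    by (subst measure_orthogonal_image[OF g]) auto
  also have "\<dots> = (\<Prod>b\<in>Basis. (u - l) \<bullet> b)"
    using le by (simp add: measure_lborel_box)
  finally show "emeasure (distr lborel borel f) (box l u) = (\<Prod>b\<in>Basis. (u - l) \<bullet> b)" .
qed simp

lemma emeasure_unit_ball:
  "emeasure lborel (ball (0 :: real ^ 'n) 1) \<noteq> 0"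
  "emeasure lborel (ball (0 :: real ^ 'n) 1) \<noteq> \<infinity>"
  "emeasure lborel (ball (0 :: real ^ 'n) 1) < \<infinity>"
  using less_imp_neq[OF unit_ball_vol_pos[of "real CARD('n)"], symmetric]
  by (simp_all add: emeasure_ball)

interpretation surface: prob_space "normalized_surface_measure :: (real ^ 'n) measure"
  unfolding normalized_surface_measure_def
  by (intro prob_space.prob_space_distr prob_space_uniform_measure emeasure_unit_ball) simp

lemma sets_normalized_surface_measure [simp, measurable_cong]:
  "sets normalized_surface_measure = sets borel"
  by (simp add: normalized_surface_measure_def)

lemma space_normalized_surface_measure [simp]: "space normalized_surface_measure = UNIV"
  by (simp add: normalized_surface_measure_def)

lemma surface_measure_UNIV: "measure (normalized_surface_measure :: (real ^ 'n) measure) UNIV = 1"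
  using surface.prob_space[where 'n = 'n] unfolding space_normalized_surface_measure .

text \<open>At the origin the projection takes the value 0, since \<open>inverse 0 = 0\<close>; this
  single point is a null set.\<close>

lemma AE_normalized_surface_measure:
  "AE x in (normalized_surface_measure :: (real ^ 'n) measure). norm x = 1"
proof -
  have "AE x :: real ^ 'n in lborel. x \<noteq> 0"
    by (rule AE_lborel_singleton)
  then have "AE x :: real ^ 'n in lborel. norm (x /\<^sub>R norm x) = 1"
    by eventually_elim simp
  then show ?thesis
    unfolding normalized_surface_measure_def
    by (subst AE_distr_iff) (auto intro!: AE_uniform_measureI elim: eventually_mono)
qed

text \<open>An orthogonal map commutes with the radial projection and preserves the unit ball, which
  reduces the claim to the invariance of Lebesgue measure.\<close>

lemma normalized_surface_measure_orthogonal: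
  fixes f :: "real ^ 'n::{finite,wellorder} \<Rightarrow> real ^ 'n::_"
  assumes f: "orthogonal_transformation f"
  shows "distr normalized_surface_measure borel f = normalized_surface_measure"
proof (rule measure_eqI)
  have lin: "linear f" and norm: "norm (f x) = norm x" for x
    using f by (auto simp: orthogonal_transformation_linear orthogonal_transformation_norm)
  have [measurable]: "f \<in> borel_measurable borel"
    by (intro borel_measurable_continuous_onI linear_continuous_on
        linear_conv_bounded_linear[THEN iffD1] lin)
  fix S :: "(real ^ 'n::_) set"
  assume "S \<in> sets (distr normalized_surface_measure borel f)"
  then have [measurable]: "S \<in> sets borel"
    by simp
  define p :: "real ^ 'n::_ \<Rightarrow> real ^ 'n::_" where "p x = x /\<^sub>R norm x" for x
  have [measurable]: "p \<in> borel_measurable borel"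
    unfolding p_def by measurable
  have fp: "f (p x) = p (f x)" for x
    by (simp add: p_def linear_scale[OF lin] norm)
  have eq: "emeasure normalized_surface_measure A =
      emeasure lborel (ball 0 1 \<inter> p -` A) / emeasure lborel (ball (0 :: real ^ 'n::_) 1)"
    if [measurable]: "A \<in> sets borel" for A
    unfolding normalized_surface_measure_def p_def[symmetric]
    by (subst emeasure_distr) (auto simp: measurable_sets_borel[of p borel A])
  have "emeasure (distr normalized_surface_measure borel f) S =
      emeasure normalized_surface_measure (f -` S)"
    by (subst emeasure_distr) auto
  also have "\<dots> = emeasure lborel (ball 0 1 \<inter> p -` f -` S) / emeasure lborel (ball (0 :: real ^ 'n::_) 1)"
    by (intro eq measurable_sets_borel[of f borel]) auto
  also have "ball 0 1 \<inter> p -` f -` S = f -` (ball 0 1 \<inter> p -` S)"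
    by (auto simp: fp norm)
  also have "emeasure lborel \<dots> = emeasure (distr lborel borel f) (ball 0 1 \<inter> p -` S)"
    using measurable_sets_borel[of p borel S] by (subst emeasure_distr) auto
  also have "\<dots> = emeasure lborel (ball 0 1 \<inter> p -` S)"
    by (simp only: lborel_distr_orthogonal_transformation[OF f])
  finally show "emeasure (distr normalized_surface_measure borel f) S =
      emeasure normalized_surface_measure S"
    by (simp add: eq)
qed simp

text \<open>The measure lives on the whole space, where polynomials are unbounded; they are bounded
  on the compact sphere, hence almost everywhere.\<close>

lemma integrable_surface_polynomial:
  fixes f :: "real ^ 'n \<Rightarrow> real"
  assumes "real_polynomial_function f"
  shows "integrable normalized_surface_measure f"
proof -
  have "continuous_on UNIV f"
    using continuous_real_polymonial_function[OF assms]
    by (simp add: continuous_on_eq_continuous_within)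
  then have [measurable]: "f \<in> borel_measurable borel"
    by (rule borel_measurable_continuous_onI)
  have "compact (f ` sphere 0 1)"
    by (intro compact_continuous_image continuous_on_subset[OF \<open>continuous_on UNIV f\<close>]) auto
  then obtain B where "\<And>x. norm x = 1 \<Longrightarrow> norm (f x) \<le> B"
    by (force dest!: compact_imp_bounded simp: bounded_iff)
  then show ?thesis
    by (intro surface.integrable_const_bound[of f B]
        eventually_mono[OF AE_normalized_surface_measure]) auto
qed

definition surface_average :: "(real ^ 'n \<Rightarrow> real) \<Rightarrow> real" where
  "surface_average p = (\<integral>x. p x \<partial>normalized_surface_measure)"

interpretation surface_average: polynomial_functional surface_average
  by unfold_locales
     (auto simp: surface_average_def integrable_surface_polynomial Bochner_Integration.integral_add)

lemma surface_average_orthogonal: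
  fixes f :: "real ^ 'n::{finite,wellorder} \<Rightarrow> real ^ 'n::_"
  assumes f: "orthogonal_transformation f" and p: "real_polynomial_function p"
  shows "surface_average (\<lambda>x. p (f x)) = surface_average p"
proof -
  have "f \<in> borel_measurable borel"
    by (intro borel_measurable_continuous_onI linear_continuous_on
        linear_conv_bounded_linear[THEN iffD1] orthogonal_transformation_linear[OF f])
  then have "surface_average (\<lambda>x. p (f x)) = (\<integral>x. p x \<partial>distr normalized_surface_measure borel f)"
    unfolding surface_average_def
    using borel_measurable_integrable[OF integrable_surface_polynomial[OF p]]
    by (subst integral_distr) (auto cong: measurable_cong_sets)
  then show ?thesis
    by (simp add: normalized_surface_measure_orthogonal[OF f] surface_average_def)
qed

lemma surface_average_power_odd:
  fixes y :: "real ^ 'n::{finite,wellorder}"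
  assumes "odd k"
  shows "surface_average (\<lambda>x. (x \<bullet> y) ^ k) = 0"
proof -
  have poly: "real_polynomial_function (\<lambda>x. (x \<bullet> y) ^ k)"
    by (intro real_polynomial_function_power real_polynomial_function_inner_left)
  have "surface_average (\<lambda>x. (- x \<bullet> y) ^ k) = surface_average (\<lambda>x. (x \<bullet> y) ^ k)"
    by (rule surface_average_orthogonal[OF _ poly]) (simp add: orthogonal_transformation_neg)
  moreover have "surface_average (\<lambda>x. (- x \<bullet> y) ^ k) = - surface_average (\<lambda>x. (x \<bullet> y) ^ k)"
    using surface_average.scale[OF poly, of "- 1"] assms by simp
  ultimately show ?thesis
    by simp
qed

text \<open>Rotation invariance makes the moment of order \<open>2 * Suc l\<close> a constant
  \<open>c\<close> times \<open>(y \<bullet> y) ^ Suc l\<close>, and \<open>moment_recursion\<close>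
  then determines \<open>c\<close> from the moment of order \<open>2 * l\<close>.\<close>

lemma surface_average_power_even:
  fixes y :: "real ^ 'n::{finite,wellorder}"
  shows "surface_average (\<lambda>x. (x \<bullet> y) ^ (2 * l)) =
    (\<Prod>j<l. (2 * real j + 1) / (real CARD('n) + 2 * real j)) * (y \<bullet> y) ^ l"
proof (induction l arbitrary: y)
  case 0
  show ?case
    by (simp add: surface_average_def surface_measure_UNIV)
next
  case (Suc l)
  obtain i :: 'n where True by simp
  define e :: "real ^ 'n::_" where "e = axis i 1"
  have "norm e = 1"
    by (simp add: e_def)
  define c where "c = surface_average (\<lambda>x. (x \<bullet> e) ^ (2 * Suc l))"
  have c: "surface_average (\<lambda>x. (x \<bullet> y) ^ (2 * Suc l)) = c * (y \<bullet> y) ^ Suc l" for y :: "real ^ 'n::_"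
  proof -
    have "norm y = norm (norm y *\<^sub>R e)"
      by (simp add: \<open>norm e = 1\<close>)
    then obtain f where f: "orthogonal_transformation f" "f y = norm y *\<^sub>R e"
      using orthogonal_transformation_exists[of y "norm y *\<^sub>R e"] by metis
    have poly: "real_polynomial_function (\<lambda>x. (x \<bullet> v) ^ (2 * Suc l))" for v :: "real ^ 'n::_"
      by (intro real_polynomial_function_power real_polynomial_function_inner_left)
    have "surface_average (\<lambda>x. (x \<bullet> y) ^ (2 * Suc l)) =
        surface_average (\<lambda>x. (f x \<bullet> (norm y *\<^sub>R e)) ^ (2 * Suc l))"
      unfolding f(2)[symmetric] using f(1) by (simp add: orthogonal_transformation_def)
    also have "\<dots> = surface_average (\<lambda>x. (x \<bullet> (norm y *\<^sub>R e)) ^ (2 * Suc l))"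
      by (rule surface_average_orthogonal[OF f(1) poly])
    also have "\<dots> = surface_average (\<lambda>x. norm y ^ (2 * Suc l) * (x \<bullet> e) ^ (2 * Suc l))"
      by (simp only: inner_scaleR_right power_mult_distrib)
    also have "\<dots> = norm y ^ (2 * Suc l) * c"
      unfolding c_def by (rule surface_average.scale[OF poly])
    also have "norm y ^ (2 * Suc l) = (y \<bullet> y) ^ Suc l"
      by (simp only: power_mult dot_square_norm)
    finally show ?thesis
      by simp
  qed
  have E: "(\<Sum>e\<in>Basis. (v \<bullet> e)\<^sup>2) = v \<bullet> v" for v :: "real ^ 'n::_"
    by (simp only: euclidean_inner[of v v] power2_eq_square)
  have unit: "surface_average (\<lambda>x. (x \<bullet> x) * (x \<bullet> y) ^ (2 * l)) =
      surface_average (\<lambda>x. (x \<bullet> y) ^ (2 * l))" for y :: "real ^ 'n::_"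
    unfolding surface_average_def
    by (rule integral_cong_AE)
       (auto intro!: eventually_mono[OF AE_normalized_surface_measure] simp: dot_square_norm)
  have "(2 * real l + 1) * surface_average (\<lambda>x. (x \<bullet> e) ^ (2 * l)) =
      c * (real (card (Basis :: (real ^ 'n::_) set)) + 2 * real l) * (e \<bullet> e) ^ l"
    by (rule surface_average.moment_recursion[OF finite_Basis E _ c unit]) (simp add: inner_Basis)
  moreover have "e \<bullet> e = 1"
    using \<open>norm e = 1\<close> by (simp add: dot_square_norm)
  moreover have "real CARD('n) + 2 * real l > 0"
    by (simp add: add_pos_nonneg)
  moreover have "surface_average (\<lambda>x. (x \<bullet> e) ^ (2 * l)) =
      (\<Prod>j<l. (2 * real j + 1) / (real CARD('n) + 2 * real j))"
    unfolding Suc.IH by (simp only: \<open>e \<bullet> e = 1\<close> power_one mult_1_right)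
  ultimately have "c = (2 * real l + 1) / (real CARD('n) + 2 * real l) *
      (\<Prod>j<l. (2 * real j + 1) / (real CARD('n) + 2 * real j))"
    by (simp add: eq_divide_eq mult_ac)
  then show ?case
    unfolding c by (simp only: prod.lessThan_Suc mult.commute mult.assoc)
qed

text \<open>Polarization of the difference functional carries its vanishing from powers of linear
  forms to all monomials of the same degree. All \<open>k \<le> \<tau>\<close> occur because the
  polynomials are not assumed homogeneous.\<close>

lemma spherical_designI:
  fixes C :: "(real ^ 'n::{finite,wellorder}) set"
  assumes "spherical_code C" "C \<noteq> {}"
    and powers: "\<And>k y. k \<le> \<tau> \<Longrightarrow>
      (\<Sum>x\<in>C. (x \<bullet> y) ^ k) / real (card C) = surface_average (\<lambda>x. (x \<bullet> y) ^ k)"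
  shows "spherical_design \<tau> C"
proof -
  define \<Lambda> where "\<Lambda> p = (\<Sum>x\<in>C. p x) / real (card C) - surface_average p" for p
  interpret polynomial_functional \<Lambda>
    by unfold_locales
       (simp_all add: \<Lambda>_def surface_average.add surface_average.scale sum.distrib
          add_divide_distrib right_diff_distrib sum_distrib_left)
  have mono: "\<Lambda> (\<lambda>x. \<Prod>i\<in>UNIV. (x $ i) ^ \<alpha> i) = 0" if "(\<Sum>i\<in>UNIV. \<alpha> i) \<le> \<tau>" for \<alpha> :: "'n \<Rightarrow> nat"
  proof -
    obtain zs :: "(real ^ 'n::_) list" where zs: "length zs = (\<Sum>i\<in>UNIV. \<alpha> i)"
      "\<And>x. (\<Prod>i\<in>UNIV. (x $ i) ^ \<alpha> i) = (\<Prod>z\<leftarrow>zs. x \<bullet> z)"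
      using monomial_eq_prod_list_inner by blast
    have "\<Lambda> (\<lambda>x. 1 * (\<Prod>z\<leftarrow>zs. x \<bullet> z)) = 0"
      using that powers zs(1)
      by (intro polarization real_polynomial_function.intros(2)) (simp add: \<Lambda>_def)
    then show ?thesis
      by (simp add: zs(2))
  qed
  have "\<Lambda> p = 0" if "polynomial_of_total_degree_le \<tau> p" for p
  proof -
    from that obtain A c where A: "finite A" "\<forall>\<alpha>\<in>A. (\<Sum>i\<in>UNIV. \<alpha> i) \<le> \<tau>"
      and p: "p = (\<lambda>x. \<Sum>\<alpha>\<in>A. c \<alpha> * (\<Prod>i\<in>UNIV. (x $ i) ^ \<alpha> i))"
      unfolding polynomial_of_total_degree_le_def by blast
    have poly: "real_polynomial_function (\<lambda>x :: real ^ 'n::_. \<Prod>i\<in>UNIV. (x $ i) ^ \<alpha> i)" for \<alpha>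
      by (intro real_polynomial_function_prod real_polynomial_function_power
          real_polynomial_function_vec_nth) auto
    have "\<Lambda> p = (\<Sum>\<alpha>\<in>A. \<Lambda> (\<lambda>x. c \<alpha> * (\<Prod>i\<in>UNIV. (x $ i) ^ \<alpha> i)))"
      unfolding p
      by (intro sum[OF A(1)] real_polynomial_function.intros(2,4) poly)
    also have "\<dots> = 0"
      using A(2) by (simp add: scale poly mono)
    finally show ?thesis .
  qed
  then show ?thesis
    using assms(1,2) by (simp add: spherical_design_def \<Lambda>_def surface_average_def)
qed

section \<open>The linear programming bound\<close>

text \<open>The definition sums over a set of exponent vectors, whereas sums and products of
  polynomials produce repeated exponents. Grouping the indices by their exponent vector merges the
  repetitions.\<close>

lemma polynomial_of_total_degree_le_indexed:
  fixes \<alpha> :: "'s \<Rightarrow> 'n::finite \<Rightarrow> nat"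
  assumes "finite S" "\<And>s. s \<in> S \<Longrightarrow> (\<Sum>i\<in>UNIV. \<alpha> s i) \<le> d"
  shows "polynomial_of_total_degree_le d (\<lambda>x. \<Sum>s\<in>S. c s * (\<Prod>i\<in>UNIV. (x $ i) ^ \<alpha> s i))"
proof -
  have "(\<Sum>s\<in>S. c s * (\<Prod>i\<in>UNIV. (x $ i) ^ \<alpha> s i)) =
      (\<Sum>\<beta>\<in>\<alpha> ` S. (\<Sum>s\<in>{s \<in> S. \<alpha> s = \<beta>}. c s) * (\<Prod>i\<in>UNIV. (x $ i) ^ \<beta> i))" for x :: "real ^ 'n"
    by (subst sum.image_gen[OF assms(1), of _ \<alpha>]) (auto intro!: sum.cong simp: sum_distrib_right)
  then show ?thesis
    unfolding polynomial_of_total_degree_le_def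
    using assms
    by (intro exI[of _ "\<alpha> ` S"] exI[of _ "\<lambda>\<beta>. \<Sum>s\<in>{s \<in> S. \<alpha> s = \<beta>}. c s"]) auto
qed

lemma polynomial_of_total_degree_le_const:
  "polynomial_of_total_degree_le d (\<lambda>x :: real ^ 'n. a)"
  using polynomial_of_total_degree_le_indexed[of "{()}" "\<lambda>_ _. 0" d "\<lambda>_. a"] by simp

lemma polynomial_of_total_degree_le_add:
  fixes p q :: "real ^ 'n \<Rightarrow> real"
  assumes "polynomial_of_total_degree_le d p" "polynomial_of_total_degree_le d q"
  shows "polynomial_of_total_degree_le d (\<lambda>x. p x + q x)"
proof -
  from assms(1) obtain A a where A: "finite A" "\<forall>\<alpha>\<in>A. (\<Sum>i\<in>UNIV. \<alpha> i) \<le> d"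
      and p: "p = (\<lambda>x. \<Sum>\<alpha>\<in>A. a \<alpha> * (\<Prod>i\<in>UNIV. (x $ i) ^ \<alpha> i))"
    unfolding polynomial_of_total_degree_le_def by blast
  from assms(2) obtain B b where B: "finite B" "\<forall>\<alpha>\<in>B. (\<Sum>i\<in>UNIV. \<alpha> i) \<le> d"
      and q: "q = (\<lambda>x. \<Sum>\<alpha>\<in>B. b \<alpha> * (\<Prod>i\<in>UNIV. (x $ i) ^ \<alpha> i))"
    unfolding polynomial_of_total_degree_le_def by blast
  have "polynomial_of_total_degree_le d
      (\<lambda>x. \<Sum>s\<in>A <+> B. case_sum a b s * (\<Prod>i\<in>UNIV. (x $ i) ^ case_sum (\<lambda>\<alpha>. \<alpha>) (\<lambda>\<alpha>. \<alpha>) s i))"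
    by (rule polynomial_of_total_degree_le_indexed) (use A B in auto)
  then show ?thesis
    using A(1) B(1) by (simp add: p q sum.Plus)
qed

lemma polynomial_of_total_degree_le_mult:
  fixes p q :: "real ^ 'n \<Rightarrow> real"
  assumes "polynomial_of_total_degree_le d p" "polynomial_of_total_degree_le e q"
  shows "polynomial_of_total_degree_le (d + e) (\<lambda>x. p x * q x)"
proof -
  from assms(1) obtain A a where A: "finite A" "\<forall>\<alpha>\<in>A. (\<Sum>i\<in>UNIV. \<alpha> i) \<le> d"
      and p: "p = (\<lambda>x. \<Sum>\<alpha>\<in>A. a \<alpha> * (\<Prod>i\<in>UNIV. (x $ i) ^ \<alpha> i))"
    unfolding polynomial_of_total_degree_le_def by blast
  from assms(2) obtain B b where B: "finite B" "\<forall>\<alpha>\<in>B. (\<Sum>i\<in>UNIV. \<alpha> i) \<le> e"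
      and q: "q = (\<lambda>x. \<Sum>\<alpha>\<in>B. b \<alpha> * (\<Prod>i\<in>UNIV. (x $ i) ^ \<alpha> i))"
    unfolding polynomial_of_total_degree_le_def by blast
  have "polynomial_of_total_degree_le (d + e)
      (\<lambda>x. \<Sum>s\<in>A \<times> B. (a (fst s) * b (snd s)) * (\<Prod>i\<in>UNIV. (x $ i) ^ (fst s i + snd s i)))"
    by (rule polynomial_of_total_degree_le_indexed)
       (use A B in \<open>auto simp: sum.distrib intro!: add_mono\<close>)
  moreover have "p x * q x =
      (\<Sum>s\<in>A \<times> B. (a (fst s) * b (snd s)) * (\<Prod>i\<in>UNIV. (x $ i) ^ (fst s i + snd s i)))" for x
    by (simp add: p q sum_product sum.cartesian_product power_add prod.distrib case_prod_beta mult_ac)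
  ultimately show ?thesis
    by simp
qed

lemma polynomial_of_total_degree_le_mono:
  "polynomial_of_total_degree_le d p \<Longrightarrow> d \<le> e \<Longrightarrow> polynomial_of_total_degree_le e p"
  unfolding polynomial_of_total_degree_le_def by (elim exE conjE, intro exI conjI) auto

lemma polynomial_of_total_degree_le_sum:
  assumes "finite J" "\<And>j. j \<in> J \<Longrightarrow> polynomial_of_total_degree_le d (p j)"
  shows "polynomial_of_total_degree_le d (\<lambda>x. \<Sum>j\<in>J. p j x)"
  using assms
  by (induction J rule: finite_induct)
     (auto simp: polynomial_of_total_degree_le_const polynomial_of_total_degree_le_add)

lemma polynomial_of_total_degree_le_nth:
  "polynomial_of_total_degree_le 1 (\<lambda>x :: real ^ 'n. x $ i)"
proof -
  have "polynomial_of_total_degree_le 1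
      (\<lambda>x :: real ^ 'n. \<Sum>s\<in>{()}. 1 * (\<Prod>j\<in>UNIV. (x $ j) ^ (if j = i then 1 else 0)))"
    by (rule polynomial_of_total_degree_le_indexed) auto
  moreover have "(\<Prod>j\<in>UNIV. (x $ j) ^ (if j = i then 1 else 0)) = x $ i" for x :: "real ^ 'n"
    by (subst prod.remove[of _ i]) auto
  ultimately show ?thesis
    by simp
qed

lemma polynomial_of_total_degree_le_inner_power:
  fixes y :: "real ^ 'n"
  shows "polynomial_of_total_degree_le k (\<lambda>x. (x \<bullet> y) ^ k)"
proof (induction k)
  case (Suc k)
  have "polynomial_of_total_degree_le (0 + 1) (\<lambda>x. y $ i * x $ i)" for i
    by (intro polynomial_of_total_degree_le_mult polynomial_of_total_degree_le_const
        polynomial_of_total_degree_le_nth)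
  then have "polynomial_of_total_degree_le 1 (\<lambda>x. x \<bullet> y)"
    by (auto simp: inner_vec_def mult.commute intro!: polynomial_of_total_degree_le_sum)
  from polynomial_of_total_degree_le_mult[OF this Suc] show ?case
    by simp
qed (simp add: polynomial_of_total_degree_le_const)

lemma polynomial_of_total_degree_le_zonal:
  fixes y :: "real ^ 'n"
  assumes "degree f \<le> d"
  shows "polynomial_of_total_degree_le d (\<lambda>x. poly f (x \<bullet> y))"
proof -
  have "polynomial_of_total_degree_le (0 + i) (\<lambda>x. coeff f i * (x \<bullet> y) ^ i)" for i
    by (intro polynomial_of_total_degree_le_mult polynomial_of_total_degree_le_const
        polynomial_of_total_degree_le_inner_power)
  then show ?thesis
    unfolding poly_altdef using assms
    by (intro polynomial_of_total_degree_le_sum)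
       (auto intro: polynomial_of_total_degree_le_mono)
qed

text \<open>The average over the sphere of the \<open>k\<close>-th power of a coordinate: for even
  \<open>k\<close>, the quotient of 1 * 3 * ... * (k - 1) by n * (n + 2) * ... * (n + k -
  2).\<close>

definition sphere_moment :: "nat \<Rightarrow> nat \<Rightarrow> real" where
  "sphere_moment n k =
     (if even k then \<Prod>j<k div 2. (2 * real j + 1) / (real n + 2 * real j) else 0)"

text \<open>The algebraic meeting point of both theories: the surface average of a zonal function
  and the normalized integral against the Gegenbauer weight are both shown equal to it.\<close>

definition zonal_average :: "nat \<Rightarrow> real poly \<Rightarrow> real" where
  "zonal_average n f = (\<Sum>i\<le>degree f. coeff f i * sphere_moment n i)"

lemma surface_average_power:
  fixes y :: "real ^ 'n::{finite,wellorder}"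
  shows "surface_average (\<lambda>x. (x \<bullet> y) ^ k) = sphere_moment CARD('n) k * norm y ^ k"
proof (cases "even k")
  case True
  then obtain l where "k = 2 * l"
    by blast
  then show ?thesis
    using surface_average_power_even[of y l]
    by (simp add: sphere_moment_def dot_square_norm flip: power_mult)
qed (simp add: surface_average_power_odd sphere_moment_def)

lemma surface_average_zonal:
  fixes y :: "real ^ 'n::{finite,wellorder}"
  assumes "norm y = 1"
  shows "surface_average (\<lambda>x. poly f (x \<bullet> y)) = zonal_average CARD('n) f"
proof -
  have poly: "real_polynomial_function (\<lambda>x. (x \<bullet> y) ^ i)" for i
    by (intro real_polynomial_function_power real_polynomial_function_inner_left)
  have "surface_average (\<lambda>x. poly f (x \<bullet> y)) =
      (\<Sum>i\<le>degree f. surface_average (\<lambda>x. coeff f i * (x \<bullet> y) ^ i))"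
    unfolding poly_altdef
    by (intro surface_average.sum real_polynomial_function.intros(2,4) poly) simp
  then show ?thesis
    using assms by (simp add: surface_average.scale poly surface_average_power zonal_average_def)
qed

text \<open>Summing \<open>f (x \<bullet> y)\<close> over \<open>x \<in> C\<close> for a single \<open>y \<in> C\<close> suffices, since \<open>degree f \<le> \<tau>\<close>.\<close>

lemma linear_programming_bound:
  fixes C :: "(real ^ 'n::{finite,wellorder}) set"
  assumes C: "spherical_design \<tau> C" "avoiding T C"
    and f: "degree f \<le> \<tau>" "\<And>t. t \<in> {-1..1} - T \<Longrightarrow> poly f t \<ge> 0"
  shows "poly f 1 \<le> zonal_average CARD('n) f * real (card C)"
proof -
  from C(1) have fin: "finite C" and sphere: "C \<subseteq> sphere 0 1" and "C \<noteq> {}"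
    by (auto simp: spherical_design_def spherical_code_def)
  then obtain y where "y \<in> C"
    by blast
  with sphere have "norm y = 1"
    by auto
  have "(\<Sum>x\<in>C. poly f (x \<bullet> y)) / real (card C) = surface_average (\<lambda>x. poly f (x \<bullet> y))"
    using C(1) polynomial_of_total_degree_le_zonal[OF f(1)]
    by (auto simp: spherical_design_def surface_average_def)
  then have sum: "(\<Sum>x\<in>C. poly f (x \<bullet> y)) = zonal_average CARD('n) f * real (card C)"
    using fin \<open>C \<noteq> {}\<close> by (simp add: surface_average_zonal[OF \<open>norm y = 1\<close>] field_simps)
  have "poly f (x \<bullet> y) \<ge> 0" if "x \<in> C" "x \<noteq> y" for x
  proof (rule f(2))
    have "x \<bullet> y \<notin> T"
      using C(2) that \<open>y \<in> C\<close> by (auto simp: avoiding_def inner_products_def)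
    moreover have "\<bar>x \<bullet> y\<bar> \<le> 1"
      using Cauchy_Schwarz_ineq2[of x y] sphere that \<open>norm y = 1\<close> by auto
    ultimately show "x \<bullet> y \<in> {-1..1} - T"
      by auto
  qed
  \<comment> \<open>Dropping these terms leaves only \<open>x = y\<close>, which contributes
    \<open>poly f 1\<close>.\<close>
  then have "(\<Sum>x\<in>C - {y}. poly f (x \<bullet> y)) \<ge> 0"
    by (intro sum_nonneg) auto
  moreover have "y \<bullet> y = 1"
    using \<open>norm y = 1\<close> by (simp add: dot_square_norm)
  ultimately show ?thesis
    using sum by (simp add: sum.remove[OF fin \<open>y \<in> C\<close>])
qed

section \<open>Gegenbauer polynomials\<close>

definition gegenbauer_integral :: "nat \<Rightarrow> real poly \<Rightarrow> real" where
  "gegenbauer_integral n p = (LBINT t:{-1..1}. poly p t * (1 - t\<^sup>2) powr ((real n - 3) / 2))"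

lemma continuous_on_gegenbauer_weight:
  assumes "a > 0"
  shows "continuous_on {-1..1 :: real} (\<lambda>t. (1 - t\<^sup>2) powr a)"
  using assms
  by (intro continuous_on_powr' continuous_intros) (auto simp: abs_square_le_1)

text \<open>For \<open>n > 3\<close> the exponent of the weight is positive, so the integrand is
  continuous up to the endpoints and thus integrable; this is the source of that assumption in what
  follows.\<close>

lemma continuous_on_gegenbauer_integrand:
  assumes "n > 3"
  shows "continuous_on {-1..1} (\<lambda>t. poly p t * (1 - t\<^sup>2) powr ((real n - 3) / 2))"
  using assms by (intro continuous_intros continuous_on_gegenbauer_weight) auto

lemma gegenbauer_integral_add:
  assumes "n > 3"
  shows "gegenbauer_integral n (p + q) = gegenbauer_integral n p + gegenbauer_integral n q"
  unfolding gegenbauer_integral_def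
  by (subst set_integral_add(2)[symmetric])
     (auto intro!: borel_integrable_atLeastAtMost' continuous_on_gegenbauer_integrand assms
        simp: algebra_simps)

lemma gegenbauer_integral_smult:
  "gegenbauer_integral n (smult c p) = c * gegenbauer_integral n p"
  by (simp add: gegenbauer_integral_def mult.assoc)

lemma gegenbauer_integral_0 [simp]: "gegenbauer_integral n 0 = 0"
  by (simp add: gegenbauer_integral_def)

lemma gegenbauer_integral_diff:
  assumes "n > 3"
  shows "gegenbauer_integral n (p - q) = gegenbauer_integral n p - gegenbauer_integral n q"
  using gegenbauer_integral_add[OF assms, of p "- q"]
    gegenbauer_integral_smult[of n "- 1" q]
  by simp

lemma gegenbauer_integral_sum:
  assumes "n > 3"
  shows "gegenbauer_integral n (\<Sum>i\<in>A. f i) = (\<Sum>i\<in>A. gegenbauer_integral n (f i))"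
  by (induction A rule: infinite_finite_induct) (simp_all add: gegenbauer_integral_add[OF assms])

text \<open>A continuous nonnegative integrand with integral 0 vanishes. The weight is positive in
  the open interval, so \<open>p\<close> has infinitely many roots. The case \<open>p = 1\<close>
  also shows that the total weight is nonzero.\<close>

lemma gegenbauer_integral_square_eq_0:
  assumes n: "n > 3" and zero: "gegenbauer_integral n (p * p) = 0"
  shows "p = 0"
proof -
  define f where "f t = poly (p * p) t * (1 - t\<^sup>2) powr ((real n - 3) / 2)" for t
  have cont: "continuous_on {-1..1} f"
    unfolding f_def by (rule continuous_on_gegenbauer_integrand[OF n])
  have "integral {-1..1} f = 0"
    using zero set_borel_integral_eq_integral(2)[OF borel_integrable_atLeastAtMost'[OF cont]]
    by (simp add: gegenbauer_integral_def f_def)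
  then have "f t = 0" if "t \<in> {-1..1}" for t
    using integral_eq_0_iff[OF cont] that by (simp add: f_def)
  then have "poly p t = 0" if "t \<in> {-1<..<1}" for t
  proof -
    have "1 - t\<^sup>2 \<noteq> 0"
      using that abs_square_less_1[of t] by auto
    moreover have "f t = 0"
      using that \<open>\<And>t. t \<in> {-1..1} \<Longrightarrow> f t = 0\<close> by simp
    ultimately show ?thesis
      by (simp add: f_def)
  qed
  then have "{-1<..<1} \<subseteq> {t. poly p t = 0}"
    by auto
  then have "infinite {t. poly p t = 0}"
    by (rule infinite_super) (simp add: infinite_Ioo)
  then show ?thesis
    using poly_roots_finite by blast
qed

text \<open>The integrand is the derivative of \<open>(1 - t\<^sup>2) powr ((n - 1) / 2) * poly g t\<close>, which vanishes
  at \<open>\<plusminus>1\<close>.\<close>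

lemma gegenbauer_integral_derivative:
  assumes n: "n > 3"
  shows "gegenbauer_integral n ([:1, 0, -1:] * pderiv g - smult (real n - 1) ([:0, 1:] * g)) = 0"
proof -
  define h where "h = [:1, 0, -1:] * pderiv g - smult (real n - 1) ([:0, 1:] * g)"
  define f where "f t = poly h t * (1 - t\<^sup>2) powr ((real n - 3) / 2)" for t
  define F where "F t = (1 - t\<^sup>2) powr ((real n - 1) / 2) * poly g t" for t
  have cont: "continuous_on {-1..1} f"
    unfolding f_def by (rule continuous_on_gegenbauer_integrand[OF n])
  have "(f has_integral F 1 - F (- 1)) {-1..1}"
  proof (rule fundamental_theorem_of_calculus_interior)
    show "continuous_on {-1..1} F"
      unfolding F_def using n by (intro continuous_intros continuous_on_gegenbauer_weight) auto
    fix t :: real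
    assume "t \<in> {-1<..<1}"
    then have pos: "1 - t\<^sup>2 > 0"
      by (auto simp: abs_square_less_1)
    have e: "(real n - 1) / 2 = (real n - 3) / 2 + 1" "(real n - 1) / 2 - 1 = (real n - 3) / 2"
      by (auto simp: field_simps)
    have "(F has_real_derivative
        ((real n - 1) / 2 * (1 - t\<^sup>2) powr ((real n - 1) / 2 - 1) * (- 2 * t)) * poly g t +
        (1 - t\<^sup>2) powr ((real n - 1) / 2) * poly (pderiv g) t) (at t)"
      unfolding F_def using pos
      by (auto intro!: derivative_eq_intros DERIV_fun_powr simp: power2_eq_square)
    also have "((real n - 1) / 2 * (1 - t\<^sup>2) powr ((real n - 1) / 2 - 1) * (- 2 * t)) * poly g t +
        (1 - t\<^sup>2) powr ((real n - 1) / 2) * poly (pderiv g) t = f t"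
      unfolding e(2) unfolding e(1) powr_add
      using pos by (simp add: f_def h_def field_simps power2_eq_square)
    finally show "(F has_vector_derivative f t) (at t)"
      by (simp add: has_real_derivative_iff_has_vector_derivative)
  qed simp
  then have "integral {-1..1} f = 0"
    by (simp add: F_def integral_unique)
  then show ?thesis
    using set_borel_integral_eq_integral(2)[OF borel_integrable_atLeastAtMost'[OF cont]]
    unfolding gegenbauer_integral_def h_def[symmetric] by (simp add: f_def)
qed

section \<open>Moments of the Gegenbauer weight\<close>

lemma sphere_moment_Suc_Suc:
  assumes "n > 0"
  shows "(real k + real n) * sphere_moment n (Suc (Suc k)) = (real k + 1) * sphere_moment n k"
proof (cases "even k")
  case True
  then obtain l where k: "k = 2 * l"
    by blast
  have "real n + 2 * real l \<noteq> 0"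
    using assms by simp
  then show ?thesis
    by (simp add: sphere_moment_def k add_ac)
qed (simp add: sphere_moment_def)

text \<open>Integration by parts with \<open>g = monom 1 (Suc l)\<close> relates the moments of
  order \<open>l\<close> and \<open>l + 2\<close> exactly as \<open>sphere_moment_Suc_Suc\<close>
  does; \<open>g = 1\<close> makes the first moment vanish.\<close>

lemma gegenbauer_integral_moment:
  assumes n: "n > 3"
  shows "gegenbauer_integral n (monom 1 k) = sphere_moment n k * gegenbauer_integral n 1"
proof (induction k rule: less_induct)
  case (less k)
  consider "k = 0" | "k = 1" | l where "k = Suc (Suc l)"
    by (metis One_nat_def not0_implies_Suc)
  then show ?case
  proof cases
    case 1
    then show ?thesis
      by (simp add: sphere_moment_def)
  next
    case 2
    have "[:1, 0, -1:] * pderiv 1 - smult (real n - 1) ([:0, 1:] * 1) = smult (1 - real n) (monom 1 k)"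
      using 2 by (simp add: monom_altdef)
    then have "(1 - real n) * gegenbauer_integral n (monom 1 k) = 0"
      using gegenbauer_integral_derivative[OF n, of 1] by (simp only: gegenbauer_integral_smult)
    then show ?thesis
      using 2 n by (simp add: sphere_moment_def)
  next
    case 3
    have "[:1, 0, -1:] * pderiv (monom 1 (Suc l)) - smult (real n - 1) ([:0, 1:] * monom 1 (Suc l)) =
        smult (real l + 1) (monom 1 l) - smult (real l + real n) (monom 1 k)"
      by (rule poly_eqI) (auto simp: 3 pderiv_monom coeff_pCons algebra_simps split: nat.splits)
    then have "(real l + real n) * gegenbauer_integral n (monom 1 k) =
        (real l + 1) * gegenbauer_integral n (monom 1 l)"
      using gegenbauer_integral_derivative[OF n, of "monom 1 (Suc l)"]
      by (simp only: gegenbauer_integral_smult gegenbauer_integral_diff[OF n])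
    moreover have "gegenbauer_integral n (monom 1 l) = sphere_moment n l * gegenbauer_integral n 1"
      using less 3 by simp
    moreover have "(real l + real n) * sphere_moment n k = (real l + 1) * sphere_moment n l"
      using n 3 sphere_moment_Suc_Suc[of n l] by simp
    ultimately have "(real l + real n) * gegenbauer_integral n (monom 1 k) =
        (real l + real n) * (sphere_moment n k * gegenbauer_integral n 1)"
      by (simp add: mult.assoc[symmetric])
    then show ?thesis
      using n by simp
  qed
qed

lemma gegenbauer_integral_eq_zonal_average:
  assumes n: "n > 3"
  shows "gegenbauer_integral n f = zonal_average n f * gegenbauer_integral n 1"
proof -
  have "gegenbauer_integral n f = gegenbauer_integral n (\<Sum>i\<le>degree f. smult (coeff f i) (monom 1 i))"
    by (simp add: smult_monom poly_as_sum_of_monoms)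
  then show ?thesis
    by (simp add: gegenbauer_integral_sum[OF n] gegenbauer_integral_smult
        gegenbauer_integral_moment[OF n] zonal_average_def sum_distrib_right mult.assoc)
qed

text \<open>Expansion of the Gegenbauer polynomial in powers of \<open>1 - t\<close>; the recursion is the one of the
  hypergeometric function \<open>\<^sub>2F\<^sub>1(- k, k + n - 2; (n - 1) / 2; (1 - t) / 2)\<close>.\<close>

primrec gegenbauer_coeff :: "nat \<Rightarrow> nat \<Rightarrow> nat \<Rightarrow> real" where
  "gegenbauer_coeff n k 0 = 1"
| "gegenbauer_coeff n k (Suc j) = gegenbauer_coeff n k j *
     (real j * (real j + real n - 2) - real k * (real k + real n - 2)) /
     ((real j + 1) * (2 * real j + real n - 1))"

definition gegenbauer_poly_shifted :: "nat \<Rightarrow> nat \<Rightarrow> real poly" where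
  "gegenbauer_poly_shifted n k = (\<Sum>j\<le>k. monom (gegenbauer_coeff n k j) j)"

definition gegenbauer_poly :: "nat \<Rightarrow> nat \<Rightarrow> real poly" where
  "gegenbauer_poly n k = pcompose (gegenbauer_poly_shifted n k) [:1, -1:]"

text \<open>Distinct eigenvalues serve twice: they keep the recursion for the coefficients from
  terminating before \<open>k\<close>, and they force orthogonality of the eigenfunctions.\<close>

lemma gegenbauer_eigenvalue_strict_mono:
  assumes "n > 3" "i < j"
  shows "real i * (real i + real n - 2) < real j * (real j + real n - 2)"
  using assms by (intro mult_strict_mono') auto

text \<open>The numerator of the recursion vanishes at \<open>j = k\<close>, so the hypergeometric
  series terminates.\<close>

lemma gegenbauer_coeff_eq_0: "j > k \<Longrightarrow> gegenbauer_coeff n k j = 0"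
proof (induction j)
  case (Suc j)
  then show ?case
    by (cases "j = k") auto
qed simp

lemma gegenbauer_coeff_neq_0:
  assumes "n > 3"
  shows "j \<le> k \<Longrightarrow> gegenbauer_coeff n k j \<noteq> 0"
proof (induction j)
  case (Suc j)
  then show ?case
    using assms gegenbauer_eigenvalue_strict_mono[OF assms, of j k] by auto
qed simp

lemma coeff_gegenbauer_poly_shifted: "coeff (gegenbauer_poly_shifted n k) j = gegenbauer_coeff n k j"
proof -
  have "coeff (gegenbauer_poly_shifted n k) j =
      (\<Sum>i\<le>k. if i = j then gegenbauer_coeff n k i else 0)"
    by (simp add: gegenbauer_poly_shifted_def coeff_sum)
  then show ?thesis
    by (simp add: gegenbauer_coeff_eq_0)
qed

lemma degree_gegenbauer_poly:
  assumes "n > 3"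
  shows "degree (gegenbauer_poly n k) = k"
proof -
  have "degree (gegenbauer_poly_shifted n k) = k"
    using gegenbauer_coeff_neq_0[OF assms, of k k]
    by (intro antisym degree_le le_degree)
       (auto simp: coeff_gegenbauer_poly_shifted gegenbauer_coeff_eq_0)
  then show ?thesis
    by (simp add: gegenbauer_poly_def degree_pcompose)
qed

lemma poly_gegenbauer_poly_1: "poly (gegenbauer_poly n k) 1 = 1"
  using coeff_gegenbauer_poly_shifted[of n k 0]
  by (simp add: gegenbauer_poly_def poly_pcompose poly_0_coeff_0)

lemma gegenbauer_differential_equation:
  fixes n k :: nat
  assumes "n > 3"
  defines "P \<equiv> gegenbauer_poly n k"
  shows "[:1, 0, -1:] * pderiv (pderiv P) - smult (real n - 1) ([:0, 1:] * pderiv P) =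
    smult (- (real k * (real k + real n - 2))) P"
proof -
  define q where "q = gegenbauer_poly_shifted n k"
  have rec: "gegenbauer_coeff n k (Suc j) * ((real j + 1) * (2 * real j + real n - 1)) =
      gegenbauer_coeff n k j * (real j * (real j + real n - 2) - real k * (real k + real n - 2))" for j
    using assms by (simp del: of_nat_Suc)
  \<comment> \<open>With \<open>u = 1 - t\<close>, the factor \<open>1 - t\<^sup>2\<close> becomes
    \<open>2 * u - u\<^sup>2\<close>, and the sign of the first derivative changes. Comparing
    coefficients of powers of \<open>u\<close> gives the recursion.\<close>
  have q: "[:0, 2, -1:] * pderiv (pderiv q) + smult (real n - 1) ([:1, -1:] * pderiv q) =
      smult (- (real k * (real k + real n - 2))) q"
  proof (rule poly_eqI)
    fix j
    show "coeff ([:0, 2, -1:] * pderiv (pderiv q) + smult (real n - 1) ([:1, -1:] * pderiv q)) j =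
        coeff (smult (- (real k * (real k + real n - 2))) q) j"
      using rec[of j]
      by (auto simp: q_def coeff_gegenbauer_poly_shifted coeff_pCons coeff_pderiv algebra_simps
          simp del: gegenbauer_coeff.simps split: nat.splits)
  qed
  have P: "P = pcompose q [:1, -1:]"
    by (simp add: P_def q_def gegenbauer_poly_def)
  have P': "pderiv P = - pcompose (pderiv q) [:1, -1:]"
    by (simp add: P pderiv_pcompose pderiv_pCons)
  have P'': "pderiv (pderiv P) = pcompose (pderiv (pderiv q)) [:1, -1:]"
    by (simp add: P' pderiv_minus pderiv_pcompose pderiv_pCons)
  show ?thesis
  proof (rule poly_eq_poly_eq_iff[THEN iffD1], rule ext)
    fix t :: real
    show "poly ([:1, 0, -1:] * pderiv (pderiv P) - smult (real n - 1) ([:0, 1:] * pderiv P)) t =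
        poly (smult (- (real k * (real k + real n - 2))) P) t"
      using arg_cong[OF q, of "\<lambda>p. poly p (1 - t)"]
      unfolding P'' unfolding P' unfolding P by (simp add: poly_pcompose algebra_simps)
  qed
qed

text \<open>Sturm-Liouville argument: eigenfunctions of a symmetric operator for distinct
  eigenvalues are orthogonal.\<close>

lemma is_gegenbauer_family_gegenbauer_poly:
  assumes n: "n > 3"
  shows "is_gegenbauer_family n (gegenbauer_poly n)"
proof -
  have "gegenbauer_integral n (gegenbauer_poly n i * gegenbauer_poly n j) = 0" if "i \<noteq> j" for i j
  proof -
    define P Q where "P = gegenbauer_poly n i" and "Q = gegenbauer_poly n j"
    define a b where "a = real i * (real i + real n - 2)" and "b = real j * (real j + real n - 2)"
    have "a \<noteq> b"
      using that gegenbauer_eigenvalue_strict_mono[OF n, of i j]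
        gegenbauer_eigenvalue_strict_mono[OF n, of j i]
      by (cases i j rule: linorder_cases) (auto simp: a_def b_def)
    \<comment> \<open>The Wronskian. In its derivative the products of first derivatives cancel,
      which gives Lagrange's identity.\<close>
    define g where "g = pderiv P * Q - P * pderiv Q"
    have "[:1, 0, -1:] * pderiv g - smult (real n - 1) ([:0, 1:] * g) =
        ([:1, 0, -1:] * pderiv (pderiv P) - smult (real n - 1) ([:0, 1:] * pderiv P)) * Q -
        P * ([:1, 0, -1:] * pderiv (pderiv Q) - smult (real n - 1) ([:0, 1:] * pderiv Q))"
      unfolding g_def pderiv_diff pderiv_mult
      by (rule poly_eq_poly_eq_iff[THEN iffD1], rule ext) (simp add: algebra_simps)
    also have "\<dots> = smult (b - a) (P * Q)"
      unfolding P_def Q_def a_def b_def gegenbauer_differential_equation[OF n]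
      by (rule poly_eq_poly_eq_iff[THEN iffD1], rule ext) (simp add: algebra_simps)
    finally have "(b - a) * gegenbauer_integral n (P * Q) = 0"
      using gegenbauer_integral_derivative[OF n, of g] by (simp only: gegenbauer_integral_smult)
    then show ?thesis
      using \<open>a \<noteq> b\<close> by (simp add: P_def Q_def)
  qed
  then show ?thesis
    using n
    by (simp add: is_gegenbauer_family_def degree_gegenbauer_poly poly_gegenbauer_poly_1
        gegenbauer_integral_def)
qed

section \<open>Expansion in an orthogonal family and uniqueness of the family\<close>

lemma poly_expansion_in_graded_basis:
  fixes P :: "nat \<Rightarrow> 'a::field poly"
  assumes "\<And>i. degree (P i) = i" "P 0 \<noteq> 0" "degree f \<le> d"
  shows "\<exists>c. f = (\<Sum>i\<le>d. smult (c i) (P i))"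
  using assms(3)
proof (induction d arbitrary: f)
  case 0
  obtain a b where "f = [:a:]" "P 0 = [:b:]"
    using 0 assms(1)[of 0] degree_0_id by (metis le_zero_eq degree_eq_zeroE)
  then show ?case
    using assms(2) by (auto intro!: exI[of _ "\<lambda>_. a / b"])
next
  case (Suc d)
  define a where "a = coeff f (Suc d) / coeff (P (Suc d)) (Suc d)"
  have "coeff (P (Suc d)) (Suc d) \<noteq> 0"
    using assms(1)[of "Suc d"] by (metis leading_coeff_0_iff degree_0 nat.distinct(1))
  then have "coeff (f - smult a (P (Suc d))) (Suc d) = 0"
    by (simp add: a_def)
  moreover have "degree (f - smult a (P (Suc d))) \<le> Suc d"
    using Suc.prems assms(1)[of "Suc d"] degree_smult_le[of a "P (Suc d)"]
    by (intro degree_diff_le) auto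
  ultimately have "degree (f - smult a (P (Suc d))) \<le> d"
    by (metis le_SucE leading_coeff_0_iff degree_0 le0)
  then obtain c where "f - smult a (P (Suc d)) = (\<Sum>i\<le>d. smult (c i) (P i))"
    using Suc.IH by blast
  then have "f = (\<Sum>i\<le>d. smult (c i) (P i)) + smult a (P (Suc d))"
    by (simp add: algebra_simps)
  also have "\<dots> = (\<Sum>i\<le>Suc d. smult ((c(Suc d := a)) i) (P i))"
    by simp
  finally show ?case
    by blast
qed

lemma gegenbauer_family_orthogonal:
  assumes "is_gegenbauer_family n P" "i \<noteq> j"
  shows "gegenbauer_integral n (P i * P j) = 0"
  using assms by (simp add: is_gegenbauer_family_def gegenbauer_integral_def)

lemma gegenbauer_family_0:
  assumes "is_gegenbauer_family n P"
  shows "P 0 = 1"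
proof -
  have "degree (P 0) = 0" "poly (P 0) 1 = 1"
    using assms by (auto simp: is_gegenbauer_family_def)
  then show ?thesis
    by (auto elim!: degree_eq_zeroE simp: one_pCons)
qed

lemma gegenbauer_family_expansion:
  assumes "is_gegenbauer_family n P" "degree f \<le> d"
  shows "\<exists>c. f = (\<Sum>i\<le>d. smult (c i) (P i))"
  using assms gegenbauer_family_0[OF assms(1)]
  by (intro poly_expansion_in_graded_basis) (auto simp: is_gegenbauer_family_def)

lemma gegenbauer_family_orthogonal_lower:
  assumes n: "n > 3" and P: "is_gegenbauer_family n P" and "degree f < i"
  shows "gegenbauer_integral n (P i * f) = 0"
proof -
  obtain c where c: "f = (\<Sum>j\<le>degree f. smult (c j) (P j))"
    using gegenbauer_family_expansion[OF P order_refl] by blast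
  have "gegenbauer_integral n (P i * f) = (\<Sum>j\<le>degree f. c j * gegenbauer_integral n (P i * P j))"
    by (subst c) (simp add: sum_distrib_left gegenbauer_integral_sum[OF n] gegenbauer_integral_smult)
  also have "\<dots> = 0"
    using assms(3) by (intro sum.neutral) (auto simp: gegenbauer_family_orthogonal[OF P])
  finally show ?thesis .
qed

text \<open>The combination \<open>r\<close> cancels the leading terms, so its degree is below
  \<open>i\<close> and it is orthogonal to both \<open>P i\<close> and \<open>Q i\<close>, hence to
  itself. The normalization at 1 then fixes the scalar.\<close>

lemma gegenbauer_family_unique:
  assumes n: "n > 3" and P: "is_gegenbauer_family n P" and Q: "is_gegenbauer_family n Q"
  shows "P = Q"
proof
  fix i
  show "P i = Q i"
  proof (cases "i = 0")
    case True
    then show ?thesis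
      by (simp add: gegenbauer_family_0[OF P] gegenbauer_family_0[OF Q])
  next
    case False
    have deg: "degree (P i) = i" "degree (Q i) = i" and one: "poly (P i) 1 = 1" "poly (Q i) 1 = 1"
      using P Q by (auto simp: is_gegenbauer_family_def)
    define a b where "a = coeff (P i) i" and "b = coeff (Q i) i"
    have "a \<noteq> 0"
      using deg(1) False by (metis a_def leading_coeff_0_iff degree_0)
    define r where "r = smult b (P i) - smult a (Q i)"
    have "coeff r i = 0"
      by (simp add: r_def a_def b_def)
    moreover have "degree r \<le> i"
      unfolding r_def using deg degree_smult_le[of b "P i"] degree_smult_le[of a "Q i"]
      by (intro degree_diff_le) auto
    ultimately have "degree r < i"
      using False by (metis degree_0 leading_coeff_0_iff le_neq_implies_less neq0_conv)
    have "gegenbauer_integral n (r * r) =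
        b * gegenbauer_integral n (P i * r) - a * gegenbauer_integral n (Q i * r)"
      by (subst (1) r_def)
         (simp add: left_diff_distrib gegenbauer_integral_diff[OF n] gegenbauer_integral_smult)
    also have "\<dots> = 0"
      using \<open>degree r < i\<close> by (simp add: gegenbauer_family_orthogonal_lower[OF n P]
          gegenbauer_family_orthogonal_lower[OF n Q])
    finally have "r = 0"
      by (rule gegenbauer_integral_square_eq_0[OF n])
    then have "smult b (P i) = smult a (Q i)"
      by (simp add: r_def)
    moreover from arg_cong[OF this, of "\<lambda>p. poly p 1"] have "b = a"
      by (simp add: one)
    ultimately show ?thesis
      using \<open>a \<noteq> 0\<close> by (metis smult_eq_0_iff smult_diff_right eq_iff_diff_eq_0)
  qed
qed

lemma is_gegenbauer_family_gegenbauer: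
  assumes "n > 3"
  shows "is_gegenbauer_family n (gegenbauer n)"
  unfolding gegenbauer_def
  by (rule theI[of _ "gegenbauer_poly n"])
     (use assms is_gegenbauer_family_gegenbauer_poly gegenbauer_family_unique in blast)+

text \<open>Integrating the expansion against \<open>gegenbauer n 0 = 1\<close> isolates the
  constant coefficient.\<close>

lemma gegenbauer_expansion_exists:
  assumes n: "n > 3"
  obtains c where "gegenbauer_expansion n f c" "c 0 = zonal_average n f"
proof -
  note P = is_gegenbauer_family_gegenbauer[OF n]
  obtain c where c: "f = (\<Sum>i\<le>degree f. smult (c i) (gegenbauer n i))"
    using gegenbauer_family_expansion[OF P order_refl] by blast
  define c' where "c' i = (if i \<le> degree f then c i else 0)" for i
  have c': "f = (\<Sum>i\<le>degree f. smult (c' i) (gegenbauer n i))"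
    by (subst c) (auto simp: c'_def intro!: sum.cong)
  have "gegenbauer_integral n f =
      (\<Sum>i\<le>degree f. c' i * gegenbauer_integral n (gegenbauer n i * gegenbauer n 0))"
    by (subst c') (simp add: gegenbauer_integral_sum[OF n] gegenbauer_integral_smult gegenbauer_family_0[OF P])
  also have "\<dots> = (\<Sum>i\<in>{0}. c' i * gegenbauer_integral n (gegenbauer n i * gegenbauer n 0))"
    by (rule sum.mono_neutral_right) (auto simp: gegenbauer_family_orthogonal[OF P])
  finally have "c' 0 * gegenbauer_integral n 1 = zonal_average n f * gegenbauer_integral n 1"
    unfolding gegenbauer_integral_eq_zonal_average[OF n, of f]
    by (auto simp: gegenbauer_family_0[OF P])
  moreover have "gegenbauer_integral n 1 \<noteq> 0"
    using gegenbauer_integral_square_eq_0[OF n, of 1] by auto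
  ultimately have "c' 0 = zonal_average n f"
    by auto
  moreover have "gegenbauer_expansion n f c'"
    using c' by (auto simp: gegenbauer_expansion_def c'_def)
  ultimately show thesis
    using that by blast
qed

section \<open>Sums over sign patterns\<close>

text \<open>A sign pattern is encoded by the set of its minus signs: all patterns on
  \<open>B\<close> are then \<open>Pow B\<close>, and parity is that of
  \<open>card N\<close>.\<close>

definition sign_on :: "'a set \<Rightarrow> 'a \<Rightarrow> real" where
  "sign_on N i = (if i \<in> N then - 1 else 1)"

lemma sum_Pow_insert:
  assumes "finite B" "b \<notin> B"
  shows "(\<Sum>N\<in>Pow (insert b B). g N) = (\<Sum>N\<in>Pow B. g N + g (insert b N))"
proof -
  have "inj_on (insert b) (Pow B)"
    using assms(2) by (auto simp: inj_on_def)
  moreover have "Pow B \<inter> insert b ` Pow B = {}"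
    using assms(2) by auto
  ultimately show ?thesis
    using assms(1) by (simp add: Pow_insert sum.union_disjoint sum.reindex sum.distrib)
qed

lemma sum_sign_on_insert:
  assumes "finite B" "b \<notin> B" "N \<subseteq> B"
  shows "(\<Sum>i\<in>insert b B. sign_on N i * y i) = y b + (\<Sum>i\<in>B. sign_on N i * y i)"
    and "(\<Sum>i\<in>insert b B. sign_on (insert b N) i * y i) = - y b + (\<Sum>i\<in>B. sign_on N i * y i)"
proof -
  have "(\<Sum>i\<in>B. sign_on (insert b N) i * y i) = (\<Sum>i\<in>B. sign_on N i * y i)"
    using assms(2) by (intro sum.cong) (auto simp: sign_on_def)
  moreover have "b \<notin> N"
    using assms by auto
  ultimately show "(\<Sum>i\<in>insert b B. sign_on N i * y i) = y b + (\<Sum>i\<in>B. sign_on N i * y i)"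
    "(\<Sum>i\<in>insert b B. sign_on (insert b N) i * y i) = - y b + (\<Sum>i\<in>B. sign_on N i * y i)"
    using assms(1,2) by (simp_all add: sign_on_def)
qed

lemma sum_signs_insert:
  assumes "finite B" "b \<notin> B"
  shows "(\<Sum>N\<in>Pow (insert b B). f (t + (\<Sum>i\<in>insert b B. sign_on N i * y i))) =
    (\<Sum>N\<in>Pow B. f ((t + y b) + (\<Sum>i\<in>B. sign_on N i * y i))) +
    (\<Sum>N\<in>Pow B. f ((t - y b) + (\<Sum>i\<in>B. sign_on N i * y i)))"
proof -
  have "f (t + (\<Sum>i\<in>insert b B. sign_on N i * y i)) + f (t + (\<Sum>i\<in>insert b B. sign_on (insert b N) i * y i)) =
      f ((t + y b) + (\<Sum>i\<in>B. sign_on N i * y i)) + f ((t - y b) + (\<Sum>i\<in>B. sign_on N i * y i))"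
    if "N \<in> Pow B" for N
    using sum_sign_on_insert[OF assms, of N y] that
    by (simp only: Pow_iff add.assoc diff_conv_add_uminus)
  then show ?thesis
    by (simp only: sum_Pow_insert[OF assms] sum.distrib[symmetric] cong: sum.cong)
qed

text \<open>The shift \<open>t\<close> is what makes the moments of a random sign sum accessible to induction.\<close>

lemma sum_signs_power2:
  assumes "finite B"
  shows "(\<Sum>N\<in>Pow B. (t + (\<Sum>i\<in>B. sign_on N i * y i)) ^ 2) =
    2 ^ card B * (t ^ 2 + (\<Sum>i\<in>B. (y i)\<^sup>2))"
  using assms
proof (induction B arbitrary: t rule: finite_induct)
  case (insert b B)
  define c :: real where "c = 2 ^ card B"
  show ?case
    unfolding sum_signs_insert[OF insert.hyps, of "\<lambda>s. s ^ 2"] insert.IH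
    unfolding sum.insert[OF insert.hyps] card_insert_disjoint[OF insert.hyps] power_Suc c_def[symmetric]
    by (simp add: algebra_simps power2_eq_square)
qed simp

text \<open>The coefficients here and for the sixth power express moments by cumulants. A random
  sign has cumulants 1, -2, 16 of orders 2, 4, 6, and cumulants add over independent signs; for
  instance -30 is 15 * (-2).\<close>

lemma sum_signs_power4:
  assumes "finite B"
  shows "(\<Sum>N\<in>Pow B. (t + (\<Sum>i\<in>B. sign_on N i * y i)) ^ 4) =
    2 ^ card B * (t ^ 4 + 6 * t ^ 2 * (\<Sum>i\<in>B. (y i)\<^sup>2) + 3 * (\<Sum>i\<in>B. (y i)\<^sup>2) ^ 2
      - 2 * (\<Sum>i\<in>B. ((y i)\<^sup>2) ^ 2))"
  using assms
proof (induction B arbitrary: t rule: finite_induct)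
  case (insert b B)
  define p q where "p = (\<Sum>i\<in>B. (y i)\<^sup>2)" and "q = (\<Sum>i\<in>B. ((y i)\<^sup>2) ^ 2)"
  define c :: real where "c = 2 ^ card B"
  show ?case
    unfolding sum_signs_insert[OF insert.hyps, of "\<lambda>s. s ^ 4"] insert.IH
    unfolding sum.insert[OF insert.hyps] card_insert_disjoint[OF insert.hyps] power_Suc c_def[symmetric] p_def[symmetric] q_def[symmetric]
    by algebra
qed simp

lemma sum_signs_power6:
  assumes "finite B"
  shows "(\<Sum>N\<in>Pow B. (t + (\<Sum>i\<in>B. sign_on N i * y i)) ^ 6) =
    2 ^ card B * (t ^ 6 + 15 * t ^ 4 * (\<Sum>i\<in>B. (y i)\<^sup>2)
      + 15 * t ^ 2 * (3 * (\<Sum>i\<in>B. (y i)\<^sup>2) ^ 2 - 2 * (\<Sum>i\<in>B. ((y i)\<^sup>2) ^ 2))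
      + 15 * (\<Sum>i\<in>B. (y i)\<^sup>2) ^ 3 - 30 * (\<Sum>i\<in>B. (y i)\<^sup>2) * (\<Sum>i\<in>B. ((y i)\<^sup>2) ^ 2)
      + 16 * (\<Sum>i\<in>B. ((y i)\<^sup>2) ^ 3))"
  using assms
proof (induction B arbitrary: t rule: finite_induct)
  case (insert b B)
  define p q r where "p = (\<Sum>i\<in>B. (y i)\<^sup>2)" and "q = (\<Sum>i\<in>B. ((y i)\<^sup>2) ^ 2)"
    and "r = (\<Sum>i\<in>B. ((y i)\<^sup>2) ^ 3)"
  define c :: real where "c = 2 ^ card B"
  show ?case
    unfolding sum_signs_insert[OF insert.hyps, of "\<lambda>s. s ^ 6"] insert.IH
    unfolding sum.insert[OF insert.hyps] card_insert_disjoint[OF insert.hyps] power_Suc c_def[symmetric] p_def[symmetric] q_def[symmetric] r_def[symmetric]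
    by algebra
qed simp

lemma sum_signs_power_odd:
  assumes "finite B" "odd k"
  shows "(\<Sum>N\<in>Pow B. (\<Sum>i\<in>B. sign_on N i * y i) ^ k) = 0"
proof -
  have neg: "(\<Sum>i\<in>B. sign_on (B - N) i * y i) = - (\<Sum>i\<in>B. sign_on N i * y i)" for N
    unfolding sum_negf[symmetric] by (rule sum.cong) (auto simp: sign_on_def)
  have "(\<Sum>N\<in>Pow B. (\<Sum>i\<in>B. sign_on N i * y i) ^ k) =
      (\<Sum>N\<in>Pow B. (\<Sum>i\<in>B. sign_on (B - N) i * y i) ^ k)"
    by (rule sum.reindex_bij_witness[of _ "\<lambda>N. B - N" "\<lambda>N. B - N"]) (auto simp: double_diff)
  also have "\<dots> = - (\<Sum>N\<in>Pow B. (\<Sum>i\<in>B. sign_on N i * y i) ^ k)"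
    using assms(2) by (simp add: neg sum_negf)
  finally show ?thesis
    by simp
qed

text \<open>Each new sign acts on \<open>p\<close> as a finite difference and lowers the degree.\<close>

lemma sum_alternating_signs_poly:
  assumes "finite B" "\<And>i. i \<ge> card B \<Longrightarrow> coeff p i = 0"
  shows "(\<Sum>N\<in>Pow B. (- 1) ^ card N * poly p (\<Sum>i\<in>B. sign_on N i * y i)) = 0"
  using assms
proof (induction B arbitrary: p rule: finite_induct)
  case empty
  then have "p = 0"
    by (intro poly_eqI) simp
  then show ?case
    by simp
next
  case (insert b B)
  define q where "q = pcompose p [:y b, 1:] - pcompose p [:- y b, 1:]"
  have deg: "degree p \<le> card B"
    using insert.prems insert.hyps by (intro degree_le) auto
  have "coeff q i = 0" if "i \<ge> card B" for i
  \<comment> \<open>At \<open>degree p\<close> the leading coefficients of the two shifted copies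
    cancel; above it both copies have coefficient 0.\<close>
  proof (cases "i = degree p")
    case True
    then show ?thesis
      using lead_coeff_comp[of "[:y b, 1:]" p] lead_coeff_comp[of "[:- y b, 1:]" p]
      by (simp add: q_def degree_pcompose)
  next
    case False
    then show ?thesis
      using deg that by (simp add: q_def coeff_eq_0 degree_pcompose)
  qed
  then have IH: "(\<Sum>N\<in>Pow B. (- 1) ^ card N * poly q (\<Sum>i\<in>B. sign_on N i * y i)) = 0"
    by (rule insert.IH)
  have "(- 1) ^ card N * poly p (\<Sum>i\<in>insert b B. sign_on N i * y i) +
      (- 1) ^ card (insert b N) * poly p (\<Sum>i\<in>insert b B. sign_on (insert b N) i * y i) =
      (- 1) ^ card N * poly q (\<Sum>i\<in>B. sign_on N i * y i)" if "N \<in> Pow B" for N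
  proof -
    have "card (insert b N) = Suc (card N)"
      using that insert.hyps finite_subset[of N B] by (subst card_insert_disjoint) auto
    moreover have "N \<subseteq> B"
      using that by simp
    ultimately show ?thesis
      unfolding sum_sign_on_insert[OF insert.hyps \<open>N \<subseteq> B\<close>]
      by (simp add: q_def poly_pcompose algebra_simps)
  qed
  then show ?case
    unfolding sum_Pow_insert[OF insert.hyps] using IH by simp
qed

text \<open>The indicator of even parity is \<open>(1 + (- 1) ^ card N) / 2\<close>, and the
  alternating part vanishes because the degree is below \<open>card B\<close>.\<close>

lemma sum_even_signs_power:
  assumes "finite B" "k < card B"
  shows "(\<Sum>N | N \<subseteq> B \<and> even (card N). (\<Sum>i\<in>B. sign_on N i * y i) ^ k) =
    (\<Sum>N\<in>Pow B. (\<Sum>i\<in>B. sign_on N i * y i) ^ k) / 2"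
proof -
  let ?s = "\<lambda>N. \<Sum>i\<in>B. sign_on N i * y i"
  have "(\<Sum>N | N \<subseteq> B \<and> even (card N). ?s N ^ k) =
      (\<Sum>N\<in>Pow B. if even (card N) then ?s N ^ k else 0)"
    using assms(1) by (intro sum.mono_neutral_cong_left) auto
  also have "\<dots> = (\<Sum>N\<in>Pow B. ?s N ^ k / 2 + (- 1) ^ card N * poly (monom 1 k) (?s N) / 2)"
    by (intro sum.cong) (auto simp: poly_monom)
  also have "\<dots> = (\<Sum>N\<in>Pow B. ?s N ^ k) / 2"
    using sum_alternating_signs_poly[OF assms(1), of "monom 1 k" y] assms(2)
    by (simp add: sum.distrib flip: sum_divide_distrib)
  finally show ?thesis .
qed

text \<open>Every two-element set comes from two ordered pairs. \<open>G\<close> also has values on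
  the diagonal, so that the double sum runs freely over both indices; the diagonal is subtracted
  afterwards.\<close>

lemma sum_over_pairs:
  fixes F :: "'a::finite set \<Rightarrow> real"
  assumes FG: "\<And>i j. i \<noteq> j \<Longrightarrow> F {i, j} = G i j"
  shows "(\<Sum>B | card B = 2. F B) = ((\<Sum>i\<in>UNIV. \<Sum>j\<in>UNIV. G i j) - (\<Sum>i\<in>UNIV. G i i)) / 2"
proof -
  have inner: "(\<Sum>p | p \<in> {(i, j). i \<noteq> j} \<and> {fst p, snd p} = B. F {fst p, snd p}) = 2 * F B"
    if "card B = 2" for B
  proof -
    from that obtain a b where ab: "B = {a, b}" "a \<noteq> b"
      by (meson card_2_iff)
    then have "{p. p \<in> {(i, j). i \<noteq> j} \<and> {fst p, snd p} = B} = {(a, b), (b, a)}"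
      by (auto simp: doubleton_eq_iff)
    then show ?thesis
      using ab by (simp add: insert_commute)
  qed
  have "(\<Sum>p\<in>{(i, j). i \<noteq> j}. F {fst p, snd p}) =
      (\<Sum>B | card B = 2. \<Sum>p | p \<in> {(i, j). i \<noteq> j} \<and> {fst p, snd p} = B. F {fst p, snd p})"
    by (rule sum.group[symmetric]) auto
  also have "\<dots> = (\<Sum>B | card B = 2. 2 * F B)"
    by (rule sum.cong[OF refl], rule inner) simp
  also have "\<dots> = 2 * (\<Sum>B | card B = 2. F B)"
    by (rule sum_distrib_left[symmetric])
  finally have "(\<Sum>p\<in>{(i, j). i \<noteq> j}. F {fst p, snd p}) = 2 * (\<Sum>B | card B = 2. F B)" .
  moreover have "(\<Sum>p\<in>{(i, j). i \<noteq> j}. F {fst p, snd p}) = (\<Sum>p\<in>{(i, j). i \<noteq> j}. G (fst p) (snd p))"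
    by (rule sum.cong) (auto simp: FG)
  ultimately have 1: "(\<Sum>p\<in>{(i, j). i \<noteq> j}. G (fst p) (snd p)) = 2 * (\<Sum>B | card B = 2. F B)"
    by simp
  have "(\<Sum>i\<in>UNIV. \<Sum>j\<in>UNIV. G i j) = (\<Sum>p\<in>UNIV. G (fst p) (snd p))"
    by (simp add: sum.cartesian_product case_prod_beta)
  also have "\<dots> = (\<Sum>p\<in>{(i, j). i \<noteq> j} \<union> {(i, j). i = j}. G (fst p) (snd p))"
    by (rule sum.cong) auto
  also have "\<dots> = (\<Sum>p\<in>{(i, j). i \<noteq> j}. G (fst p) (snd p)) + (\<Sum>p\<in>{(i, j). i = j}. G (fst p) (snd p))"
    by (rule sum.union_disjoint) auto
  also have "(\<Sum>p\<in>{(i, j). i = j}. G (fst p) (snd p)) = (\<Sum>i\<in>UNIV. G i i)"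
    by (rule sum.reindex_bij_witness[of _ "\<lambda>i. (i, i)" fst]) auto
  finally show ?thesis
    by (simp add: 1)
qed

section \<open>The first-order Reed--Muller code\<close>

definition binary_dot :: "nat \<Rightarrow> nat \<Rightarrow> nat \<Rightarrow> nat" where
  "binary_dot d m k = (\<Sum>j<d. of_bool (bit m j \<and> bit k j))"

text \<open>The characters of the group of binary vectors of length \<open>d\<close>; vectors and
  characters are both numbered by their binary digits.\<close>

definition walsh :: "nat \<Rightarrow> nat \<Rightarrow> nat \<Rightarrow> real" where
  "walsh d m k = (- 1) ^ binary_dot d m k"

lemma walsh_commute: "walsh d m k = walsh d k m"
  by (simp add: walsh_def binary_dot_def conj_commute)

lemma walsh_0 [simp]: "walsh d 0 k = 1" "walsh d k 0 = 1"
  by (simp_all add: walsh_def binary_dot_def)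

lemma walsh_square [simp]: "walsh d m k * walsh d m k = 1"
  by (simp add: walsh_def flip: power_mult_distrib)

lemma walsh_flip_bit:
  assumes "l < d"
  shows "walsh d (flip_bit l m) k = (if bit k l then - 1 else 1) * walsh d m k"
proof -
  have walsh: "walsh d m k = (- 1) ^ of_bool (bit m l \<and> bit k l) *
      (\<Prod>j\<in>{..<d} - {l}. (- 1) ^ of_bool (bit m j \<and> bit k j))" for m
    unfolding walsh_def binary_dot_def power_sum using assms by (intro prod.remove) auto
  have "(\<Prod>j\<in>{..<d} - {l}. (- 1 :: real) ^ of_bool (bit (flip_bit l m) j \<and> bit k j)) =
      (\<Prod>j\<in>{..<d} - {l}. (- 1) ^ of_bool (bit m j \<and> bit k j))"
    by (rule prod.cong) (auto simp: bit_flip_bit_iff)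
  then show ?thesis
    unfolding walsh by (auto simp: bit_flip_bit_iff)
qed

text \<open>If \<open>i\<close> and \<open>j\<close> differ in bit \<open>l\<close>, flipping bit
  \<open>l\<close> of \<open>m\<close> is an involution of the index range that negates every
  summand.\<close>

lemma walsh_orthogonal:
  assumes "i < 2 ^ d" "j < 2 ^ d"
  shows "(\<Sum>m<2 ^ d. walsh d m i * walsh d m j) = (if i = j then 2 ^ d else 0)"
proof (cases "i = j")
  case False
  have "take_bit d i \<noteq> take_bit d j"
    using False assms by (simp add: take_bit_nat_eq_self_iff[THEN iffD2])
  then obtain l where l: "l < d" "bit i l \<noteq> bit j l"
    by (auto simp: bit_eq_iff bit_take_bit_iff)
  have bound: "flip_bit l m < 2 ^ d" if "m < 2 ^ d" for m :: nat
    using that l(1) take_bit_flip_bit_eq[of d l m] by (simp flip: take_bit_nat_eq_self_iff)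
  have flip: "flip_bit l (flip_bit l m) = m" for m :: nat
    by (rule bit_eqI) (auto simp: bit_flip_bit_iff)
  have "(\<Sum>m<2 ^ d. walsh d m i * walsh d m j) =
      (\<Sum>m<2 ^ d. walsh d (flip_bit l m) i * walsh d (flip_bit l m) j)"
    by (rule sum.reindex_bij_witness[of _ "flip_bit l" "flip_bit l"]) (auto simp: flip bound)
  also have "\<dots> = - (\<Sum>m<2 ^ d. walsh d m i * walsh d m j)"
    unfolding walsh_flip_bit[OF l(1)] sum_negf[symmetric]
    using l(2) by (intro sum.cong) auto
  finally show ?thesis
    using False by simp
qed simp

section \<open>The sixteen coordinates as binary vectors of length 4, and the Walsh
  transform\<close>

lemma bij_betw_of_nat_16: "bij_betw (of_nat :: nat \<Rightarrow> 16) {..<16} UNIV"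
proof -
  have "x \<in> of_nat ` {..<16}" for x :: 16
  proof (cases x rule: bit0.cases)
    case (1 z)
    then have "x = of_nat (nat z)" "nat z < 16"
      by auto
    then show ?thesis
      by blast
  qed
  then have surj: "(of_nat :: nat \<Rightarrow> 16) ` {..<16} = UNIV"
    by blast
  moreover have "inj_on (of_nat :: nat \<Rightarrow> 16) {..<16}"
    by (rule eq_card_imp_inj_on) (simp_all add: surj)
  ultimately show ?thesis
    by (simp add: bij_betw_def)
qed

definition index16 :: "16 \<Rightarrow> nat" where
  "index16 = inv_into {..<16} of_nat"

lemma index16_less [simp]: "index16 i < 16"
  using bij_betw_of_nat_16 inv_into_into[of i of_nat "{..<16}"]
  by (auto simp: index16_def bij_betw_def)

lemma of_nat_index16 [simp]: "of_nat (index16 i) = i"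
  using bij_betw_of_nat_16 f_inv_into_f[of i of_nat "{..<16}"]
  by (auto simp: index16_def bij_betw_def)

lemma index16_of_nat [simp]: "k < 16 \<Longrightarrow> index16 (of_nat k) = k"
  using bij_betw_of_nat_16 by (simp add: index16_def bij_betw_inv_into_left)

lemma index16_eq_iff [simp]: "index16 i = index16 j \<longleftrightarrow> i = j"
  by (metis of_nat_index16)

lemma sum_index16: "(\<Sum>i\<in>UNIV. f (index16 i)) = (\<Sum>k<16. f k)"
  by (rule sum.reindex_bij_witness[of _ of_nat index16]) auto

definition walsh16 :: "nat \<Rightarrow> 16 \<Rightarrow> real" where
  "walsh16 m i = walsh 4 m (index16 i)"

lemma walsh16_cases: "walsh16 m i = 1 \<or> walsh16 m i = - 1"
  unfolding walsh16_def walsh_def by (metis neg_one_even_power neg_one_odd_power)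

lemma walsh16_0 [simp]: "walsh16 0 i = 1"
  by (simp add: walsh16_def)

lemma walsh16_orthogonal_columns:
  "(\<Sum>m<16. walsh16 m i * walsh16 m j) = (if i = j then 16 else 0)"
  using walsh_orthogonal[of "index16 i" 4 "index16 j"] by (simp add: walsh16_def)

lemma walsh16_orthogonal_rows:
  assumes "m < 16" "m' < 16"
  shows "(\<Sum>i\<in>UNIV. walsh16 m i * walsh16 m' i) = (if m = m' then 16 else 0)"
proof -
  have "(\<Sum>i\<in>UNIV. walsh16 m i * walsh16 m' i) = (\<Sum>k<16. walsh 4 m k * walsh 4 m' k)"
    unfolding walsh16_def by (rule sum_index16)
  also have "\<dots> = (\<Sum>k<2 ^ 4. walsh 4 k m * walsh 4 k m')"
    by (intro sum.cong arg_cong2[where f = "(*)"] walsh_commute) simp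
  finally show ?thesis
    using assms walsh_orthogonal[of m 4 m'] by simp
qed

lemma sum_walsh16:
  assumes "m < 16"
  shows "(\<Sum>i\<in>UNIV. walsh16 m i) = (if m = 0 then 16 else 0)"
  using walsh16_orthogonal_rows[OF assms, of 0] by simp

definition walsh_transform :: "nat \<Rightarrow> (16 \<Rightarrow> real) \<Rightarrow> real" where
  "walsh_transform m u = (\<Sum>i\<in>UNIV. walsh16 m i * u i)"

lemma walsh_transform_0: "walsh_transform 0 u = (\<Sum>i\<in>UNIV. u i)"
  by (simp add: walsh_transform_def)

lemma walsh_parseval:
  "(\<Sum>m<16. walsh_transform m u * walsh_transform m v) = 16 * (\<Sum>i\<in>UNIV. u i * v i)"
proof -
  have "(\<Sum>m<16. walsh_transform m u * walsh_transform m v) =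
      (\<Sum>m<16. \<Sum>i\<in>UNIV. \<Sum>j\<in>UNIV. u i * v j * (walsh16 m i * walsh16 m j))"
    by (simp add: walsh_transform_def sum_product mult_ac)
  also have "\<dots> = (\<Sum>i\<in>UNIV. \<Sum>m<16. \<Sum>j\<in>UNIV. u i * v j * (walsh16 m i * walsh16 m j))"
    by (rule sum.swap)
  also have "\<dots> = (\<Sum>i\<in>UNIV. \<Sum>j\<in>UNIV. \<Sum>m<16. u i * v j * (walsh16 m i * walsh16 m j))"
    by (intro sum.cong refl) (rule sum.swap)
  also have "\<dots> = (\<Sum>i\<in>UNIV. \<Sum>j\<in>UNIV. if i = j then 16 * (u i * v j) else 0)"
    unfolding sum_distrib_left[symmetric] walsh16_orthogonal_columns by (intro sum.cong) auto
  also have "\<dots> = 16 * (\<Sum>i\<in>UNIV. u i * v i)"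
    by (subst sum_distrib_left) simp
  finally show ?thesis .
qed

definition rm_sign :: "bool \<Rightarrow> real" where
  "rm_sign s = (if s then - 1 else 1)"

text \<open>The supports of the codewords: \<open>m\<close> encodes the linear part and \<open>s\<close> the constant term.\<close>

definition rm_support :: "nat \<times> bool \<Rightarrow> 16 set" where
  "rm_support p = {i. odd (binary_dot 4 (fst p) (index16 i)) \<noteq> snd p}"

lemma indicator_rm_support:
  "of_bool (i \<in> rm_support (m, s)) = (1 - rm_sign s * walsh16 m i) / 2"
  by (auto simp: rm_support_def rm_sign_def walsh16_def walsh_def)

text \<open>The two complementary supports with the same \<open>m\<close> carry the same Walsh
  coefficient with opposite signs, so odd powers of it cancel in sums over the code.\<close>

lemma sum_rm_support:
  "(\<Sum>i\<in>rm_support (m, s). u i) = ((\<Sum>i\<in>UNIV. u i) - rm_sign s * walsh_transform m u) / 2"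
proof -
  have "(\<Sum>i\<in>rm_support (m, s). u i) = (\<Sum>i\<in>UNIV. of_bool (i \<in> rm_support (m, s)) * u i)"
    by (intro sum.mono_neutral_cong_left) auto
  also have "\<dots> = (\<Sum>i\<in>UNIV. (u i - rm_sign s * (walsh16 m i * u i)) / 2)"
    unfolding indicator_rm_support by (simp add: algebra_simps)
  finally show ?thesis
    by (simp add: walsh_transform_def sum_subtractf sum_distrib_left flip: sum_divide_distrib)
qed

lemma card_rm_support:
  assumes "m \<in> {1..<16}"
  shows "card (rm_support (m, s)) = 8"
  using sum_rm_support[of "\<lambda>_. 1" m s] sum_walsh16[of m] assms
  by (simp add: walsh_transform_def)

lemma rm_support_0: "rm_support (0, False) = {}" "rm_support (0, True) = UNIV"
  by (auto simp: rm_support_def binary_dot_def)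

text \<open>Expanding the product of the indicators into Walsh functions leaves 16 / 4 times an
  integer. This divisibility later makes the inner products of the minimal vectors even.\<close>

lemma card_rm_support_Int:
  assumes "m < 16" "m' < 16"
  shows "4 dvd card (rm_support (m, s) \<inter> rm_support (m', s'))"
proof -
  have "real (card (rm_support (m, s) \<inter> rm_support (m', s'))) =
      (\<Sum>i\<in>UNIV. of_bool (i \<in> rm_support (m, s)) * of_bool (i \<in> rm_support (m', s')))"
    by (simp add: of_bool_conj[symmetric] Int_def del: of_bool_conj)
  also have "\<dots> = (\<Sum>i\<in>UNIV. (1 - rm_sign s * walsh16 m i - rm_sign s' * walsh16 m' i +
      rm_sign s * rm_sign s' * (walsh16 m i * walsh16 m' i)) / 4)"
    unfolding indicator_rm_support by (intro sum.cong) (simp_all add: field_simps)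
  also have "\<dots> = 4 * (1 - rm_sign s * of_bool (m = 0) - rm_sign s' * of_bool (m' = 0) +
      rm_sign s * rm_sign s' * of_bool (m = m'))"
    unfolding sum_divide_distrib[symmetric] sum.distrib sum_subtractf sum_distrib_left[symmetric]
    using assms by (simp add: walsh16_orthogonal_rows sum_walsh16)
  also have "\<dots> = real_of_int (4 * (1 - (if s then - 1 else 1) * of_bool (m = 0)
      - (if s' then - 1 else 1) * of_bool (m' = 0)
      + (if s then - 1 else 1) * (if s' then - 1 else 1) * of_bool (m = m')))"
    by (simp add: rm_sign_def)
  finally have "int (card (rm_support (m, s) \<inter> rm_support (m', s'))) =
      4 * (1 - (if s then - 1 else 1) * of_bool (m = 0)
      - (if s' then - 1 else 1) * of_bool (m' = 0)
      + (if s then - 1 else 1) * (if s' then - 1 else 1) * of_bool (m = m'))"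
    by linarith
  then have "(4 :: int) dvd int (card (rm_support (m, s) \<inter> rm_support (m', s')))"
    by (metis dvd_triv_left)
  then show ?thesis
    by presburger
qed

text \<open>The 30 codewords of weight 8; \<open>m = 0\<close> stands for the empty support and the
  full one.\<close>

definition rm_blocks :: "(nat \<times> bool) set" where
  "rm_blocks = {1..<16} \<times> UNIV"

lemma inj_on_rm_support: "inj_on rm_support rm_blocks"
proof (rule inj_onI)
  fix p q
  assume "p \<in> rm_blocks" "q \<in> rm_blocks" and eq: "rm_support p = rm_support q"
  then obtain m s m' s' where p: "p = (m, s)" "q = (m', s')"
    and m: "m < 16" "m' < 16"
    by (auto simp: rm_blocks_def)
  have eq': "rm_sign s * walsh16 m i = rm_sign s' * walsh16 m' i" for i
    using indicator_rm_support[of i m s] indicator_rm_support[of i m' s'] eq p by simp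
  have "m = m'"
  proof (rule ccontr)
    assume "m \<noteq> m'"
    have "rm_sign s * (\<Sum>i\<in>UNIV. walsh16 m i * walsh16 m i) =
        rm_sign s' * (\<Sum>i\<in>UNIV. walsh16 m' i * walsh16 m i)"
      unfolding sum_distrib_left mult.assoc[symmetric] eq' ..
    then show False
      using \<open>m \<noteq> m'\<close> m by (simp add: walsh16_orthogonal_rows rm_sign_def split: if_splits)
  qed
  with eq'[of 0] have "rm_sign s = rm_sign s'"
    using walsh16_cases[of m 0] by auto
  then show "p = q"
    using p \<open>m = m'\<close> by (auto simp: rm_sign_def split: if_splits)
qed

lemma sum_rm_blocks: "(\<Sum>p\<in>rm_blocks. f p) = (\<Sum>m\<in>{1..<16}. f (m, False) + f (m, True))"
  unfolding rm_blocks_def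
  by (simp add: sum.cartesian_product' UNIV_bool)

lemma sum_from_1_to_15:
  fixes f :: "nat \<Rightarrow> real"
  shows "(\<Sum>m\<in>{1..<16}. f m) = (\<Sum>m<16. f m) - f 0"
proof -
  have "{..<16} = insert 0 {1..<16 :: nat}"
    by auto
  then show ?thesis
    by simp
qed

section \<open>Power sums over the 30 blocks\<close>

lemma sum_blocks_1:
  fixes u :: "16 \<Rightarrow> real"
  shows "(\<Sum>p\<in>rm_blocks. \<Sum>i\<in>rm_support p. u i) = 15 * (\<Sum>i\<in>UNIV. u i)"
  by (simp add: sum_rm_blocks sum_rm_support rm_sign_def field_simps)

text \<open>Two functions are allowed because the sixth moment involves the sum of \<open>u\<close>
  times the sum of its squares.\<close>

lemma sum_blocks_2:
  fixes u v :: "16 \<Rightarrow> real"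
  shows "(\<Sum>p\<in>rm_blocks. (\<Sum>i\<in>rm_support p. u i) * (\<Sum>i\<in>rm_support p. v i)) =
    7 * (\<Sum>i\<in>UNIV. u i) * (\<Sum>i\<in>UNIV. v i) + 8 * (\<Sum>i\<in>UNIV. u i * v i)"
proof -
  define P Q where "P = (\<Sum>i\<in>UNIV. u i)" and "Q = (\<Sum>i\<in>UNIV. v i)"
  have "(\<Sum>p\<in>rm_blocks. (\<Sum>i\<in>rm_support p. u i) * (\<Sum>i\<in>rm_support p. v i)) =
      (\<Sum>m\<in>{1..<16}. P * Q / 2 + walsh_transform m u * walsh_transform m v / 2)"
    unfolding sum_rm_blocks sum_rm_support P_def[symmetric] Q_def[symmetric]
    by (intro sum.cong) (auto simp: rm_sign_def field_simps)
  also have "\<dots> = 15 * (P * Q / 2) + (16 * (\<Sum>i\<in>UNIV. u i * v i) - P * Q) / 2"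
    unfolding sum.distrib sum_divide_distrib[symmetric] sum_from_1_to_15 walsh_parseval
    by (simp add: walsh_transform_0 P_def Q_def)
  also have "\<dots> = 7 * P * Q + 8 * (\<Sum>i\<in>UNIV. u i * v i)"
    by (simp add: field_simps)
  finally show ?thesis
    unfolding P_def Q_def .
qed

text \<open>Adding complementary blocks removes the linear and cubic terms in the Walsh
  coefficients, so the quadratic identity of Parseval still suffices for the cube.\<close>

lemma sum_blocks_3:
  fixes u :: "16 \<Rightarrow> real"
  shows "(\<Sum>p\<in>rm_blocks. (\<Sum>i\<in>rm_support p. u i) ^ 3) =
    3 * (\<Sum>i\<in>UNIV. u i) ^ 3 + 12 * (\<Sum>i\<in>UNIV. u i) * (\<Sum>i\<in>UNIV. (u i)\<^sup>2)"
proof -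
  define P where "P = (\<Sum>i\<in>UNIV. u i)"
  have "(\<Sum>p\<in>rm_blocks. (\<Sum>i\<in>rm_support p. u i) ^ 3) =
      (\<Sum>m\<in>{1..<16}. P ^ 3 / 4 + 3 * P / 4 * (walsh_transform m u * walsh_transform m u))"
    unfolding sum_rm_blocks sum_rm_support P_def[symmetric]
    by (intro sum.cong) (auto simp: rm_sign_def field_simps power3_eq_cube)
  also have "\<dots> = 15 * (P ^ 3 / 4) + 3 * P / 4 * (16 * (\<Sum>i\<in>UNIV. u i * u i) - P * P)"
    unfolding sum.distrib sum_distrib_left[symmetric] sum_from_1_to_15 walsh_parseval
    by (simp add: walsh_transform_0 P_def)
  also have "\<dots> = 3 * P ^ 3 + 12 * P * (\<Sum>i\<in>UNIV. (u i)\<^sup>2)"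
    by (simp add: field_simps power3_eq_cube power2_eq_square)
  finally show ?thesis
    unfolding P_def .
qed

section \<open>Power sums over the minimal vectors\<close>

definition signed_vector :: "real \<Rightarrow> 'n set \<Rightarrow> 'n set \<Rightarrow> real ^ 'n" where
  "signed_vector r B N = (\<chi> i. if i \<in> B then r * sign_on N i else 0)"

lemma inner_signed_vector:
  fixes y :: "real ^ 'n"
  shows "signed_vector r B N \<bullet> y = r * (\<Sum>i\<in>B. sign_on N i * y $ i)"
proof -
  have "signed_vector r B N \<bullet> y = (\<Sum>i\<in>UNIV. if i \<in> B then r * (sign_on N i * y $ i) else 0)"
    by (auto simp: inner_vec_def signed_vector_def intro!: sum.cong)
  also have "\<dots> = (\<Sum>i\<in>B. r * (sign_on N i * y $ i))"
    by (simp add: sum.If_cases)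
  finally show ?thesis
    by (simp add: sum_distrib_left)
qed

lemma signed_vector_inject:
  assumes "r > 0" "N \<subseteq> B" "N' \<subseteq> B'"
  shows "signed_vector r B N = signed_vector r B' N' \<longleftrightarrow> B = B' \<and> N = N'"
proof
  assume eq: "signed_vector r B N = signed_vector r B' N'"
  have *: "B = {i. signed_vector r B N $ i \<noteq> 0}" "N = {i. signed_vector r B N $ i < 0}"
    if "N \<subseteq> B" for B N :: "'a set"
    using \<open>r > 0\<close> that by (auto simp: signed_vector_def sign_on_def)
  show "B = B' \<and> N = N'"
    using *[OF assms(2)] *[OF assms(3)] eq by metis
qed auto

text \<open>Integer coordinates, before the factor \<open>1 / sqrt 2\<close>: minimal vectors have
  squared norm 8 there. There are 120 * 4 = 480 with two entries of absolute value 2, and 30 * 128 =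
  3840 \<open>block_vectors\<close> with eight entries of absolute value 1.\<close>

definition pair_vectors :: "(real ^ 16) set" where
  "pair_vectors = {signed_vector 2 B N | B N. card B = 2 \<and> N \<subseteq> B}"

definition block_vectors :: "(real ^ 16) set" where
  "block_vectors =
     {signed_vector 1 (rm_support p) N | p N. p \<in> rm_blocks \<and> N \<subseteq> rm_support p \<and> even (card N)}"

definition bw_vectors :: "(real ^ 16) set" where
  "bw_vectors = pair_vectors \<union> block_vectors"

lemma sum_signed_vectors:
  fixes J :: "'j set" and y :: "real ^ 'n"
  assumes "r > 0" "finite J" "inj_on S J" "\<And>j. j \<in> J \<Longrightarrow> \<N> j \<subseteq> Pow (S j)"
  shows "(\<Sum>z\<in>{signed_vector r (S j) N | j N. j \<in> J \<and> N \<in> \<N> j}. (z \<bullet> y) ^ k) =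
    r ^ k * (\<Sum>j\<in>J. \<Sum>N\<in>\<N> j. (\<Sum>i\<in>S j. sign_on N i * y $ i) ^ k)"
proof -
  define g where "g p = signed_vector r (S (fst p)) (snd p)" for p
  have inj: "inj_on g (Sigma J \<N>)"
  proof (rule inj_onI)
    fix p q
    assume "p \<in> Sigma J \<N>" "q \<in> Sigma J \<N>" "g p = g q"
    moreover from this have "S (fst p) = S (fst q) \<and> snd p = snd q"
      unfolding g_def using assms(1,4)
      by (subst (asm) signed_vector_inject) (auto simp: subset_iff)
    ultimately show "p = q"
      using inj_onD[OF assms(3), of "fst p" "fst q"] by (auto simp: prod_eq_iff)
  qed
  have fin: "finite (\<N> j)" if "j \<in> J" for j
    using assms(4)[OF that] by (rule finite_subset) simp
  have img: "{signed_vector r (S j) N | j N. j \<in> J \<and> N \<in> \<N> j} = g ` Sigma J \<N>"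
    by (force simp: g_def image_iff)
  have "(\<Sum>z\<in>g ` Sigma J \<N>. (z \<bullet> y) ^ k) =
      (\<Sum>p\<in>Sigma J \<N>. r ^ k * (\<Sum>i\<in>S (fst p). sign_on (snd p) i * y $ i) ^ k)"
    unfolding sum.reindex[OF inj] by (simp add: g_def inner_signed_vector power_mult_distrib)
  also have "\<dots> = (\<Sum>j\<in>J. \<Sum>N\<in>\<N> j. r ^ k * (\<Sum>i\<in>S j. sign_on N i * y $ i) ^ k)"
    using assms(2) fin by (subst sum.Sigma) (auto simp: case_prod_beta)
  finally show ?thesis
    unfolding img by (simp add: sum_distrib_left)
qed

lemma sum_pair_vectors:
  "(\<Sum>z\<in>pair_vectors. (z \<bullet> y) ^ k) =
    2 ^ k * (\<Sum>B | card B = 2. \<Sum>N\<in>Pow B. (\<Sum>i\<in>B. sign_on N i * y $ i) ^ k)"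
  using sum_signed_vectors[of 2 "{B. card B = 2}" "\<lambda>B. B" "Pow" y k]
  by (simp add: pair_vectors_def Pow_def)

lemma finite_rm_blocks: "finite rm_blocks"
  by (simp add: rm_blocks_def)

lemma card_rm_support_block: "p \<in> rm_blocks \<Longrightarrow> card (rm_support p) = 8"
  using card_rm_support by (cases p) (auto simp: rm_blocks_def)

lemma sum_block_vectors:
  assumes "k < 8"
  shows "(\<Sum>z\<in>block_vectors. (z \<bullet> y) ^ k) =
    (\<Sum>p\<in>rm_blocks. (\<Sum>N\<in>Pow (rm_support p). (\<Sum>i\<in>rm_support p. sign_on N i * y $ i) ^ k) / 2)"
proof -
  have even: "(\<Sum>N | N \<subseteq> rm_support p \<and> even (card N). (\<Sum>i\<in>rm_support p. sign_on N i * y $ i) ^ k) =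
      (\<Sum>N\<in>Pow (rm_support p). (\<Sum>i\<in>rm_support p. sign_on N i * y $ i) ^ k) / 2"
    if "p \<in> rm_blocks" for p
    using that assms by (intro sum_even_signs_power) (auto simp: card_rm_support_block)
  have img: "block_vectors = {signed_vector 1 (rm_support p) N | p N.
      p \<in> rm_blocks \<and> N \<in> {N. N \<subseteq> rm_support p \<and> even (card N)}}"
    by (simp add: block_vectors_def)
  show ?thesis
    unfolding img
    by (subst sum_signed_vectors[OF _ finite_rm_blocks inj_on_rm_support])
       (auto simp: even cong: sum.cong)
qed

lemma finite_bw_vectors: "finite pair_vectors" "finite block_vectors"
proof -
  have "pair_vectors \<subseteq> (\<lambda>(B, N). signed_vector 2 B N) ` UNIV"
    "block_vectors \<subseteq> (\<lambda>(B, N). signed_vector 1 B N) ` UNIV"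
    by (auto simp: pair_vectors_def block_vectors_def)
  then show "finite pair_vectors" "finite block_vectors"
    by (auto intro: finite_subset)
qed

lemma pair_block_vectors_disjoint: "pair_vectors \<inter> block_vectors = {}"
proof -
  have "\<exists>i. \<bar>z $ i\<bar> = 2" if "z \<in> pair_vectors" for z
  proof -
    from that obtain B N where z: "z = signed_vector 2 B N" "card B = 2"
      by (auto simp: pair_vectors_def)
    then obtain i where "i \<in> B"
      by fastforce
    then show ?thesis
      by (auto simp: z signed_vector_def sign_on_def intro!: exI[of _ i])
  qed
  moreover have "\<bar>z $ i\<bar> \<noteq> 2" if "z \<in> block_vectors" for z i
    using that by (auto simp: block_vectors_def signed_vector_def sign_on_def split: if_splits)
  ultimately show ?thesis
    by blast
qed

lemma sum_bw_vectors:
  "(\<Sum>z\<in>bw_vectors. f z) = (\<Sum>z\<in>pair_vectors. f z) + (\<Sum>z\<in>block_vectors. f z)"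
  unfolding bw_vectors_def
  by (rule sum.union_disjoint) (simp_all add: finite_bw_vectors pair_block_vectors_disjoint)

lemma sum_bw_vectors_odd:
  assumes "k < 8" "odd k"
  shows "(\<Sum>z\<in>bw_vectors. (z \<bullet> y) ^ k) = 0"
  using assms by (simp add: sum_bw_vectors sum_pair_vectors sum_block_vectors sum_signs_power_odd)

lemma sum_bw_vectors_0: "(\<Sum>z\<in>bw_vectors. (z \<bullet> y) ^ 0) = 4320"
proof -
  have "(\<Sum>z\<in>pair_vectors. (z \<bullet> y) ^ 0) = (\<Sum>B :: 16 set | card B = 2. 4)"
    unfolding sum_pair_vectors
    by (simp del: sum_constant) (rule sum.cong, auto simp: card_Pow)
  also have "\<dots> = 480"
    using sum_over_pairs[of "\<lambda>_. 4" "\<lambda>(_ :: 16) _. 4"] by simp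
  finally have "(\<Sum>z\<in>pair_vectors. (z \<bullet> y) ^ 0) = 480" .
  \<comment> \<open>\<open>128 = 2 ^ 8 / 2\<close>, as only the even sign patterns occur.\<close>
  moreover have "(\<Sum>z\<in>block_vectors. (z \<bullet> y) ^ 0) = (\<Sum>p\<in>rm_blocks. 128)"
    by (subst sum_block_vectors) (auto simp: card_Pow card_rm_support_block intro!: sum.cong)
  moreover have "(\<Sum>p\<in>rm_blocks. 128 :: real) = 3840"
    by (simp add: rm_blocks_def UNIV_bool)
  ultimately show ?thesis
    unfolding sum_bw_vectors by simp
qed

text \<open>The constants in this and the next two power sums are
  \<open>4320 * 8 ^ l * sphere_moment 16 (2 * l)\<close>, the values forced on a design of 4320
  vectors of squared norm 8: 4320 * 8 / 16, 4320 * 64 / 96 and 4320 * 512 / 384.\<close>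

lemma sum_bw_vectors_2: "(\<Sum>z\<in>bw_vectors. (z \<bullet> y) ^ 2) = 2160 * (y \<bullet> y)"
proof -
  define u where "u i = (y $ i)\<^sup>2" for i
  define P where "P = (\<Sum>i\<in>UNIV. u i)"
  have signs: "(\<Sum>N\<in>Pow B. (\<Sum>i\<in>B. sign_on N i * y $ i) ^ 2) = 2 ^ card B * (\<Sum>i\<in>B. u i)" for B
    using sum_signs_power2[of B 0 "\<lambda>i. y $ i"] by (simp add: u_def)
  have "(\<Sum>B :: 16 set | card B = 2. 2 ^ card B * (\<Sum>i\<in>B. u i)) =
      ((\<Sum>i\<in>UNIV. \<Sum>j\<in>UNIV. 4 * u i + 4 * u j) - (\<Sum>i\<in>UNIV. 4 * u i + 4 * u i)) / 2"
    by (rule sum_over_pairs) (simp add: algebra_simps)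
  also have "\<dots> = 60 * P"
    by (simp add: sum.distrib sum_distrib_left[symmetric] P_def)
  finally have pairs: "(\<Sum>z\<in>pair_vectors. (z \<bullet> y) ^ 2) = 240 * P"
    unfolding sum_pair_vectors signs by simp
  have "(\<Sum>z\<in>block_vectors. (z \<bullet> y) ^ 2) = (\<Sum>p\<in>rm_blocks. 128 * (\<Sum>i\<in>rm_support p. u i))"
    unfolding sum_block_vectors[of 2, simplified] signs
    by (intro sum.cong) (auto simp: card_rm_support_block)
  also have "\<dots> = 1920 * P"
    unfolding sum_distrib_left[symmetric] sum_blocks_1 by (simp add: P_def)
  finally have blocks: "(\<Sum>z\<in>block_vectors. (z \<bullet> y) ^ 2) = 1920 * P" .
  have "y \<bullet> y = P"
    by (simp add: P_def u_def inner_vec_def power2_eq_square)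
  then show ?thesis
    by (simp add: sum_bw_vectors pairs blocks)
qed

text \<open>Neither family is invariant alone: \<open>Q\<close> appears with 768 from the pairs and
  3072 - 3840 from the blocks, and cancels only in the union.\<close>

lemma sum_bw_vectors_4: "(\<Sum>z\<in>bw_vectors. (z \<bullet> y) ^ 4) = 2880 * (y \<bullet> y) ^ 2"
proof -
  define u where "u i = (y $ i)\<^sup>2" for i
  define P Q where "P = (\<Sum>i\<in>UNIV. u i)" and "Q = (\<Sum>i\<in>UNIV. (u i)\<^sup>2)"
  have signs: "(\<Sum>N\<in>Pow B. (\<Sum>i\<in>B. sign_on N i * y $ i) ^ 4) =
      2 ^ card B * (3 * (\<Sum>i\<in>B. u i) ^ 2 - 2 * (\<Sum>i\<in>B. (u i)\<^sup>2))" for B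
    using sum_signs_power4[of B 0 "\<lambda>i. y $ i"] by (simp add: u_def)
  have "(\<Sum>B :: 16 set | card B = 2. 2 ^ card B * (3 * (\<Sum>i\<in>B. u i) ^ 2 - 2 * (\<Sum>i\<in>B. (u i)\<^sup>2))) =
      ((\<Sum>i\<in>UNIV. \<Sum>j\<in>UNIV. 4 * (u i)\<^sup>2 + 4 * (u j)\<^sup>2 + 24 * (u i * u j)) -
        (\<Sum>i\<in>UNIV. 4 * (u i)\<^sup>2 + 4 * (u i)\<^sup>2 + 24 * (u i * u i))) / 2"
    by (rule sum_over_pairs) (simp add: algebra_simps power2_eq_square)
  also have "\<dots> = 48 * Q + 12 * P\<^sup>2"
    by (simp add: sum.distrib sum_distrib_left[symmetric] sum_distrib_right[symmetric] P_def Q_def power2_eq_square)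
  finally have pairs: "(\<Sum>z\<in>pair_vectors. (z \<bullet> y) ^ 4) = 16 * (48 * Q + 12 * P\<^sup>2)"
    unfolding sum_pair_vectors signs by simp
  have "(\<Sum>z\<in>block_vectors. (z \<bullet> y) ^ 4) =
      (\<Sum>p\<in>rm_blocks. 384 * ((\<Sum>i\<in>rm_support p. u i) * (\<Sum>i\<in>rm_support p. u i)) -
        256 * (\<Sum>i\<in>rm_support p. (u i)\<^sup>2))"
    unfolding sum_block_vectors[of 4, simplified] signs
    by (intro sum.cong) (auto simp: card_rm_support_block power2_eq_square)
  also have "\<dots> = 384 * (7 * P * P + 8 * Q) - 256 * (15 * Q)"
    unfolding sum_subtractf sum_distrib_left[symmetric] sum_blocks_1 sum_blocks_2
    by (simp add: P_def Q_def power2_eq_square)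
  finally have blocks: "(\<Sum>z\<in>block_vectors. (z \<bullet> y) ^ 4) =
      384 * (7 * P * P + 8 * Q) - 256 * (15 * Q)" .
  have "y \<bullet> y = P"
    by (simp add: P_def u_def inner_vec_def power2_eq_square)
  then show ?thesis
    by (simp add: sum_bw_vectors pairs blocks algebra_simps power2_eq_square)
qed

text \<open>\<open>R\<close> cancels within each family, while \<open>P * Q\<close> cancels only
  between them: 3840 from the pairs against 23040 - 26880 from the blocks.\<close>

lemma sum_bw_vectors_6: "(\<Sum>z\<in>bw_vectors. (z \<bullet> y) ^ 6) = 5760 * (y \<bullet> y) ^ 3"
proof -
  define u where "u i = (y $ i)\<^sup>2" for i
  define P Q R where "P = (\<Sum>i\<in>UNIV. u i)" and "Q = (\<Sum>i\<in>UNIV. (u i)\<^sup>2)"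
    and "R = (\<Sum>i\<in>UNIV. (u i) ^ 3)"
  have signs: "(\<Sum>N\<in>Pow B. (\<Sum>i\<in>B. sign_on N i * y $ i) ^ 6) =
      2 ^ card B * (15 * (\<Sum>i\<in>B. u i) ^ 3 - 30 * ((\<Sum>i\<in>B. u i) * (\<Sum>i\<in>B. (u i)\<^sup>2)) +
        16 * (\<Sum>i\<in>B. (u i) ^ 3))" for B
    using sum_signs_power6[of B 0 "\<lambda>i. y $ i"] by (simp add: u_def mult.assoc)
  have "(\<Sum>B :: 16 set | card B = 2. 2 ^ card B * (15 * (\<Sum>i\<in>B. u i) ^ 3 -
        30 * ((\<Sum>i\<in>B. u i) * (\<Sum>i\<in>B. (u i)\<^sup>2)) + 16 * (\<Sum>i\<in>B. (u i) ^ 3))) =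
      ((\<Sum>i\<in>UNIV. \<Sum>j\<in>UNIV. 4 * (u i) ^ 3 + 4 * (u j) ^ 3 + 60 * ((u i)\<^sup>2 * u j) + 60 * (u i * (u j)\<^sup>2)) -
        (\<Sum>i\<in>UNIV. 4 * (u i) ^ 3 + 4 * (u i) ^ 3 + 60 * ((u i)\<^sup>2 * u i) + 60 * (u i * (u i)\<^sup>2))) / 2"
    by (rule sum_over_pairs) (simp add: algebra_simps power2_eq_square power3_eq_cube)
  also have "\<dots> = ((64 * R + 64 * R + 60 * (Q * P) + 60 * (P * Q)) - (4 * R + 4 * R + 60 * R + 60 * R)) / 2"
  proof -
    have "(\<Sum>i\<in>UNIV. \<Sum>j\<in>UNIV. 60 * ((u i)\<^sup>2 * u j)) = 60 * (Q * P)"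
      "(\<Sum>i\<in>UNIV. \<Sum>j\<in>UNIV. 60 * (u i * (u j)\<^sup>2)) = 60 * (P * Q)"
      unfolding P_def Q_def sum_product by (simp_all only: sum_distrib_left)
    then show ?thesis
      unfolding sum.distrib
      by (simp add: sum_distrib_left[symmetric] R_def power2_eq_square power3_eq_cube mult.assoc)
  qed
  also have "\<dots> = 60 * (P * Q)"
    by (simp add: field_simps)
  finally have pairs: "(\<Sum>z\<in>pair_vectors. (z \<bullet> y) ^ 6) = 64 * (60 * (P * Q))"
    unfolding sum_pair_vectors signs by simp
  have "(\<Sum>z\<in>block_vectors. (z \<bullet> y) ^ 6) =
      (\<Sum>p\<in>rm_blocks. 1920 * (\<Sum>i\<in>rm_support p. u i) ^ 3 -
        3840 * ((\<Sum>i\<in>rm_support p. u i) * (\<Sum>i\<in>rm_support p. (u i)\<^sup>2)) +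
        2048 * (\<Sum>i\<in>rm_support p. (u i) ^ 3))"
    unfolding sum_block_vectors[of 6, simplified] signs
    by (intro sum.cong) (auto simp: card_rm_support_block)
  also have "\<dots> = 1920 * (3 * P ^ 3 + 12 * P * Q) - 3840 * (7 * P * Q + 8 * R) + 2048 * (15 * R)"
    unfolding sum.distrib sum_subtractf sum_distrib_left[symmetric] sum_blocks_1 sum_blocks_2 sum_blocks_3
    by (simp add: P_def Q_def R_def power2_eq_square power3_eq_cube mult.assoc)
  finally have blocks: "(\<Sum>z\<in>block_vectors. (z \<bullet> y) ^ 6) =
      1920 * (3 * P ^ 3 + 12 * P * Q) - 3840 * (7 * P * Q + 8 * R) + 2048 * (15 * R)" .
  have "y \<bullet> y = P"
    by (simp add: P_def u_def inner_vec_def power2_eq_square)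
  then show ?thesis
    by (simp add: sum_bw_vectors pairs blocks algebra_simps power2_eq_square)
qed

section \<open>The Barnes--Wall configuration\<close>

lemma of_nat_bit_eq_1_iff: "(of_nat n :: bit) = 1 \<longleftrightarrow> odd n"
  by (induction n) auto

lemma of_int_bit_eq_1_iff: "(of_int z :: bit) = 1 \<longleftrightarrow> odd z"
proof (cases "even z")
  case True
  then obtain k where "z = 2 * k"
    by blast
  then show ?thesis
    by simp
next
  case False
  then obtain k where "z = 2 * k + 1"
    by (rule oddE)
  then show ?thesis
    by simp
qed

lemma linear_form_eq_binary_dot:
  assumes "\<And>j. j < d \<Longrightarrow> a j = of_bool (bit m j)"
  shows "(\<Sum>j<d. a j * of_bool (bit k j)) = (of_nat (binary_dot d m k) :: bit)"
  unfolding binary_dot_def of_nat_sum using assms by (intro sum.cong) auto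

lemma reed_muller_1_4_iff:
  "u \<in> reed_muller_1_4 \<longleftrightarrow> (\<exists>m<16. \<exists>s. \<forall>i. u $ i = 1 \<longleftrightarrow> i \<in> rm_support (m, s))"
proof
  assume "u \<in> reed_muller_1_4"
  then obtain b a where u: "\<And>k. k < 16 \<Longrightarrow> u $ of_nat k = b + (\<Sum>j<4. a j * of_bool (bit (k :: nat) j))"
    by (auto simp: reed_muller_1_4_def)
  \<comment> \<open>The linear coefficients \<open>a 0\<close> to \<open>a 3\<close> are packed into
    the binary digits of \<open>m\<close>.\<close>
  define m :: nat where "m = horner_sum of_bool 2 (map (\<lambda>j. a j = 1) [0..<4])"
  have "m < 16"
    using horner_sum_of_bool_2_less[of "map (\<lambda>j. a j = 1) [0..<4]", where 'a = nat] by (simp add: m_def)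
  have a: "a j = of_bool (bit m j)" if "j < 4" for j
    using that by (cases "a j") (auto simp: m_def bit_horner_sum_bit_iff)
  have "u $ i = b + of_nat (binary_dot 4 m (index16 i))" for i
    using u[of "index16 i"] linear_form_eq_binary_dot[OF a, of 4] by simp
  then have "u $ i = 1 \<longleftrightarrow> i \<in> rm_support (m, b = 1)" for i
    using of_nat_bit_eq_1_iff[of "binary_dot 4 m (index16 i)"] by (cases b) (auto simp: rm_support_def)
  with \<open>m < 16\<close> show "\<exists>m<16. \<exists>s. \<forall>i. u $ i = 1 \<longleftrightarrow> i \<in> rm_support (m, s)"
    by blast
next
  assume "\<exists>m<16. \<exists>s. \<forall>i. u $ i = 1 \<longleftrightarrow> i \<in> rm_support (m, s)"
  then obtain m s where u: "\<And>i. u $ i = 1 \<longleftrightarrow> i \<in> rm_support (m, s)"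
    by blast
  have "u $ of_nat k = of_bool s + (\<Sum>j<4. of_bool (bit m j) * of_bool (bit k j))" if "k < 16" for k
    using u[of "of_nat k"] that of_nat_bit_eq_1_iff[of "binary_dot 4 m k"]
      linear_form_eq_binary_dot[of 4 "\<lambda>j. of_bool (bit m j)" m k]
    by (cases s; cases "u $ of_nat k") (auto simp: rm_support_def)
  then show "u \<in> reed_muller_1_4"
    unfolding reed_muller_1_4_def
    by (intro CollectI exI[of _ "of_bool s"] exI[of _ "\<lambda>j. of_bool (bit m j)"]) auto
qed

text \<open>The lattice scaled by \<open>sqrt 2\<close>, with the codeword condition restated
  through the set of odd coordinates.\<close>

definition bw_integer_vectors :: "(int ^ 16) set" where
  "bw_integer_vectors = {z. 4 dvd (\<Sum>i\<in>UNIV. z $ i) \<and>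
     (\<exists>m<16. \<exists>s. \<forall>i. odd (z $ i) \<longleftrightarrow> i \<in> rm_support (m, s))}"

definition real_vector_of :: "int ^ 'n \<Rightarrow> real ^ 'n" where
  "real_vector_of z = (\<chi> i. of_int (z $ i))"

lemma inner_real_vector_of:
  "real_vector_of z \<bullet> real_vector_of w = real_of_int (\<Sum>i\<in>UNIV. z $ i * w $ i)"
  by (simp add: real_vector_of_def inner_vec_def)

lemma barnes_wall_lattice_eq:
  "barnes_wall_lattice = (\<lambda>z. (1 / sqrt 2) *\<^sub>R real_vector_of z) ` bw_integer_vectors"
  by (auto simp: barnes_wall_lattice_def bw_integer_vectors_def reed_muller_1_4_iff
      of_int_bit_eq_1_iff real_vector_of_def)

section \<open>Integer vectors of squared norm 8\<close>

lemma sum_signs_int: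
  assumes "finite B" "N \<subseteq> B"
  shows "(\<Sum>i\<in>B. if i \<in> N then - r else r) = r * (int (card B) - 2 * int (card N))"
proof -
  have "(\<Sum>i\<in>B. if i \<in> N then - r else r) = (\<Sum>i\<in>B. r - (if i \<in> N then 2 * r else 0))"
    by (intro sum.cong) auto
  also have "\<dots> = r * int (card B) - 2 * r * int (card N)"
    using assms by (simp add: sum_subtractf sum.If_cases Int_absorb1)
  finally show ?thesis
    by (simp add: algebra_simps)
qed

lemma int_square_ge_1: "z \<noteq> 0 \<Longrightarrow> 1 \<le> z\<^sup>2" for z :: int
  using zero_less_power2[of z] by linarith

text \<open>Eight odd coordinates contribute at least 1 each. Equality forces entries 1 or -1 on the
  block and 0 off it, and then the sum \<open>8 - 2 * card N\<close> is divisible by 4 only for an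
  even number of minus signs.\<close>

lemma bw_integer_vector_odd:
  assumes p: "m \<in> {1..<16}" and parity: "\<And>i. odd (z $ i) \<longleftrightarrow> i \<in> rm_support (m, s)"
    and dvd: "4 dvd (\<Sum>i\<in>UNIV. z $ i)"
  shows "8 \<le> (\<Sum>i\<in>UNIV. (z $ i)\<^sup>2)"
    and "(\<Sum>i\<in>UNIV. (z $ i)\<^sup>2) = 8 \<Longrightarrow> real_vector_of z \<in> block_vectors"
proof -
  define W where "W = rm_support (m, s)"
  have card: "card W = 8"
    using card_rm_support[OF p] by (simp add: W_def)
  have split: "(\<Sum>i\<in>UNIV. (z $ i)\<^sup>2) = (\<Sum>i\<in>UNIV. (z $ i)\<^sup>2 - of_bool (i \<in> W)) + 8"
    by (simp add: sum_subtractf card)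
  have nonneg: "0 \<le> (z $ i)\<^sup>2 - of_bool (i \<in> W)" for i
    using parity[of i] int_square_ge_1[of "z $ i"] by (cases "z $ i = 0") (auto simp: W_def)
  then have "0 \<le> (\<Sum>i\<in>UNIV. (z $ i)\<^sup>2 - of_bool (i \<in> W))"
    by (intro sum_nonneg)
  then show "8 \<le> (\<Sum>i\<in>UNIV. (z $ i)\<^sup>2)"
    unfolding split by simp
  assume "(\<Sum>i\<in>UNIV. (z $ i)\<^sup>2) = 8"
  then have "(\<Sum>i\<in>UNIV. (z $ i)\<^sup>2 - of_bool (i \<in> W)) = 0"
    unfolding split by simp
  then have square: "(z $ i)\<^sup>2 = of_bool (i \<in> W)" for i
    using nonneg sum_nonneg_eq_0_iff[of UNIV "\<lambda>i. (z $ i)\<^sup>2 - of_bool (i \<in> W)"] by simp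
  define N where "N = {i. z $ i = - 1}"
  have z: "z $ i = (if i \<in> W then if i \<in> N then - 1 else 1 else 0)" for i
    using square[of i] power2_eq_1_iff[of "z $ i"] by (cases "i \<in> W") (auto simp: N_def)
  have "N \<subseteq> W"
  proof
    fix i
    assume "i \<in> N"
    then show "i \<in> W"
      using square[of i] by (cases "i \<in> W") (auto simp: N_def)
  qed
  have "(\<Sum>i\<in>UNIV. z $ i) = (\<Sum>i\<in>W. if i \<in> N then - 1 else 1)"
    by (intro sum.mono_neutral_cong_right) (auto simp: z)
  also have "\<dots> = 8 - 2 * int (card N)"
    by (subst sum_signs_int) (use \<open>N \<subseteq> W\<close> card in auto)
  finally have "even (card N)"
    using dvd by presburger
  moreover have "real_vector_of z = signed_vector 1 W N"
  proof -
    have "real_of_int (z $ i) = (if i \<in> W then 1 * sign_on N i else 0)" for i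
      by (simp add: z sign_on_def)
    then show ?thesis
      by (simp add: real_vector_of_def signed_vector_def)
  qed
  ultimately show "real_vector_of z \<in> block_vectors"
    using \<open>N \<subseteq> W\<close> p by (auto simp: block_vectors_def rm_blocks_def W_def)
qed

text \<open>Half of \<open>z\<close> has even coordinate sum, and an integer is congruent to its
  square modulo 2, so its squared norm is even and at least 2. Equality leaves two entries of
  absolute value 1.\<close>

lemma bw_integer_vector_even:
  assumes even: "\<And>i. even (z $ i)" and "z \<noteq> 0"
    and dvd: "4 dvd (\<Sum>i\<in>UNIV. z $ i)"
  shows "8 \<le> (\<Sum>i\<in>UNIV. (z $ i)\<^sup>2)"
    and "(\<Sum>i\<in>UNIV. (z $ i)\<^sup>2) = 8 \<Longrightarrow> real_vector_of z \<in> pair_vectors"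
proof -
  define w where "w i = z $ i div 2" for i
  have z: "z $ i = 2 * w i" for i
    using even[of i] by (simp add: w_def)
  have squares: "(\<Sum>i\<in>UNIV. (z $ i)\<^sup>2) = 4 * (\<Sum>i\<in>UNIV. (w i)\<^sup>2)"
    by (simp add: z power_mult_distrib sum_distrib_left)
  have "(\<Sum>i\<in>UNIV. z $ i) = 2 * (\<Sum>i\<in>UNIV. w i)"
    by (simp add: z sum_distrib_left)
  then have "2 dvd (\<Sum>i\<in>UNIV. w i)"
    using dvd by presburger
  moreover have "2 dvd (\<Sum>i\<in>UNIV. (w i)\<^sup>2 - w i)"
    by (intro dvd_sum) simp
  ultimately have even: "2 dvd (\<Sum>i\<in>UNIV. (w i)\<^sup>2)"
    unfolding sum_subtractf by presburger
  have "\<exists>i. w i \<noteq> 0"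
    using \<open>z \<noteq> 0\<close> by (auto simp: vec_eq_iff z)
  then have "(\<Sum>i\<in>UNIV. (w i)\<^sup>2) > 0"
    by (auto intro!: sum_pos2)
  with even have "(\<Sum>i\<in>UNIV. (w i)\<^sup>2) \<ge> 2"
    by presburger
  then show "8 \<le> (\<Sum>i\<in>UNIV. (z $ i)\<^sup>2)"
    by (simp add: squares)
  assume "(\<Sum>i\<in>UNIV. (z $ i)\<^sup>2) = 8"
  then have sum: "(\<Sum>i\<in>UNIV. (w i)\<^sup>2) = 2"
    by (simp add: squares)
  have w: "w i = 0 \<or> w i = 1 \<or> w i = - 1" for i
  proof (rule ccontr)
    assume "\<not> ?thesis"
    then have "2 \<le> \<bar>w i\<bar>"
      by linarith
    then have "2\<^sup>2 \<le> \<bar>w i\<bar>\<^sup>2"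
      by (rule power_mono) simp
    moreover have "(w i)\<^sup>2 \<le> (\<Sum>i\<in>UNIV. (w i)\<^sup>2)"
      by (rule member_le_sum) auto
    ultimately show False
      using sum by simp
  qed
  define B N where "B = {i. w i \<noteq> 0}" and "N = {i. w i = - 1}"
  have "(\<Sum>i\<in>UNIV. (w i)\<^sup>2) = (\<Sum>i\<in>B. 1)"
    using w by (intro sum.mono_neutral_cong_right) (auto simp: B_def power2_eq_1_iff)
  then have "card B = 2"
    using sum by simp
  moreover have "N \<subseteq> B"
    by (auto simp: N_def B_def)
  moreover have "real_vector_of z = signed_vector 2 B N"
    using w by (auto simp: vec_eq_iff real_vector_of_def signed_vector_def sign_on_def z B_def N_def)
  ultimately show "real_vector_of z \<in> pair_vectors"
    by (auto simp: pair_vectors_def)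
qed

lemma bw_integer_vector_norm:
  assumes "z \<in> bw_integer_vectors" "z \<noteq> 0"
  shows "8 \<le> (\<Sum>i\<in>UNIV. (z $ i)\<^sup>2) \<and>
    ((\<Sum>i\<in>UNIV. (z $ i)\<^sup>2) = 8 \<longrightarrow> real_vector_of z \<in> bw_vectors)"
proof -
  obtain m s where dvd: "4 dvd (\<Sum>i\<in>UNIV. z $ i)" and "m < 16"
    and parity: "\<And>i. odd (z $ i) \<longleftrightarrow> i \<in> rm_support (m, s)"
    using assms(1) by (auto simp: bw_integer_vectors_def)
  consider "m \<in> {1..<16}" | "m = 0" "s" | "m = 0" "\<not> s"
    using \<open>m < 16\<close> by fastforce
  then show ?thesis
  proof cases
    case 1
    from bw_integer_vector_odd[OF 1 parity dvd] show ?thesis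
      by (auto simp: bw_vectors_def)
  next
    case 2
    then have "odd (z $ i)" for i
      using parity[of i] by (simp add: rm_support_0)
    \<comment> \<open>The full codeword makes all coordinates odd, so the squared norm is at least
      16 and the value 8 cannot occur.\<close>
    then have "(\<Sum>i\<in>(UNIV :: 16 set). 1) \<le> (\<Sum>i\<in>UNIV. (z $ i)\<^sup>2)"
      by (intro sum_mono int_square_ge_1) (metis even_zero)
    then show ?thesis
      by simp
  next
    case 3
    then have "even (z $ i)" for i
      using parity[of i] by (simp add: rm_support_0)
    from bw_integer_vector_even[OF this assms(2) dvd] show ?thesis
      by (auto simp: bw_vectors_def)
  qed
qed

lemma signed_vector_bw:
  assumes "N \<subseteq> B" "r = 1 \<or> r = 2"
  obtains z where "real_vector_of z = signed_vector (real_of_int r) B N"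
    "(\<Sum>i\<in>UNIV. (z $ i)\<^sup>2) = r\<^sup>2 * int (card B)"
    "(\<Sum>i\<in>UNIV. z $ i) = r * (int (card B) - 2 * int (card N))"
    "\<And>i. odd (z $ i) \<longleftrightarrow> r = 1 \<and> i \<in> B"
proof
  define z where "z = (\<chi> i. if i \<in> B then if i \<in> N then - r else r else 0)"
  show "real_vector_of z = signed_vector (real_of_int r) B N"
    by (auto simp: vec_eq_iff z_def real_vector_of_def signed_vector_def sign_on_def)
  have "(\<Sum>i\<in>UNIV. (z $ i)\<^sup>2) = (\<Sum>i\<in>B. r\<^sup>2)"
    by (intro sum.mono_neutral_cong_right) (auto simp: z_def)
  then show "(\<Sum>i\<in>UNIV. (z $ i)\<^sup>2) = r\<^sup>2 * int (card B)"
    by simp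
  have "(\<Sum>i\<in>UNIV. z $ i) = (\<Sum>i\<in>B. if i \<in> N then - r else r)"
    by (intro sum.mono_neutral_cong_right) (auto simp: z_def)
  then show "(\<Sum>i\<in>UNIV. z $ i) = r * (int (card B) - 2 * int (card N))"
    by (simp add: sum_signs_int assms(1))
  show "odd (z $ i) \<longleftrightarrow> r = 1 \<and> i \<in> B" for i
    using assms(2) by (auto simp: z_def)
qed

lemma bw_vectors_integer:
  assumes "v \<in> bw_vectors"
  shows "\<exists>z\<in>bw_integer_vectors. real_vector_of z = v \<and> (\<Sum>i\<in>UNIV. (z $ i)\<^sup>2) = 8"
proof -
  consider B N where "v = signed_vector 2 B N" "card B = 2" "N \<subseteq> B"
    | p N where "v = signed_vector 1 (rm_support p) N" "p \<in> rm_blocks" "N \<subseteq> rm_support p" "even (card N)"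
    using assms by (auto simp: bw_vectors_def pair_vectors_def block_vectors_def)
  then show ?thesis
  proof cases
    case 1
    obtain z where z: "real_vector_of z = signed_vector 2 B N" "(\<Sum>i\<in>UNIV. (z $ i)\<^sup>2) = 8"
      "(\<Sum>i\<in>UNIV. z $ i) = 2 * (2 - 2 * int (card N))" "\<And>i. even (z $ i)"
      using signed_vector_bw[OF 1(3), of 2] 1(2) by auto
    have "z \<in> bw_integer_vectors"
      unfolding bw_integer_vectors_def using z(3,4) rm_support_0(1)
      by (auto intro!: exI[of _ "0 :: nat"] exI[of _ False])
    then show ?thesis
      using z 1 by blast
  next
    case 2
    then have "card (rm_support p) = 8"
      by (simp add: card_rm_support_block)
    then obtain z where z: "real_vector_of z = signed_vector 1 (rm_support p) N"
      "(\<Sum>i\<in>UNIV. (z $ i)\<^sup>2) = 8" "(\<Sum>i\<in>UNIV. z $ i) = 8 - 2 * int (card N)"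
      "\<And>i. odd (z $ i) \<longleftrightarrow> i \<in> rm_support p"
      using signed_vector_bw[OF 2(3), of 1] by auto
    have "4 dvd 8 - 2 * int (card N)"
      using 2(4) by presburger
    moreover obtain m s where "p = (m, s)" "m < 16"
      using 2(2) by (auto simp: rm_blocks_def)
    ultimately have "z \<in> bw_integer_vectors"
      unfolding bw_integer_vectors_def using z(3,4) by auto
    then show ?thesis
      using z 2 by blast
  qed
qed

lemma inner_scaled_real_vector_of:
  "((1 / sqrt 2) *\<^sub>R real_vector_of z) \<bullet> ((1 / sqrt 2) *\<^sub>R real_vector_of w) =
    real_of_int (\<Sum>i\<in>UNIV. z $ i * w $ i) / 2"
  by (simp add: inner_real_vector_of)

lemma real_vector_of_eq_0_iff: "real_vector_of z = 0 \<longleftrightarrow> z = 0"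
  by (simp add: real_vector_of_def vec_eq_iff)

lemma bw_vectors_nonempty: "bw_vectors \<noteq> {}"
  using sum_bw_vectors_0[of 0] by auto

lemma minimal_vectors_barnes_wall_lattice:
  "minimal_vectors barnes_wall_lattice = (\<lambda>v. (1 / sqrt 2) *\<^sub>R v) ` bw_vectors"
proof -
  define e where "e z = (1 / sqrt 2) *\<^sub>R real_vector_of z" for z :: "int ^ 16"
  define q where "q z = (\<Sum>i\<in>UNIV. (z $ i)\<^sup>2)" for z :: "int ^ 16"
  have norm_le: "norm (e z) \<le> norm (e w) \<longleftrightarrow> q z \<le> q w" for z w
    unfolding norm_le e_def q_def inner_scaled_real_vector_of
    by (simp add: power2_eq_square del: of_int_sum)
  have e0: "e z = 0 \<longleftrightarrow> z = 0" for z
    by (simp add: e_def real_vector_of_eq_0_iff)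
  have L: "barnes_wall_lattice = e ` bw_integer_vectors"
    by (simp add: barnes_wall_lattice_eq e_def)
  show ?thesis
  proof (intro equalityI subsetI)
    fix v
    assume v: "v \<in> minimal_vectors barnes_wall_lattice"
    then obtain z where z: "z \<in> bw_integer_vectors" "v = e z" "z \<noteq> 0"
      by (auto simp: minimal_vectors_def L e0)
    obtain w where w: "w \<in> bw_integer_vectors" "q w = 8"
      using bw_vectors_nonempty bw_vectors_integer by (auto simp: q_def)
    then have "w \<noteq> 0"
      by (auto simp: q_def)
    then have "norm (e z) \<le> norm (e w)"
      using v w(1) z(2) by (auto simp: minimal_vectors_def L e0)
    then have "q z \<le> 8"
      by (simp add: norm_le w(2))
    then have "real_vector_of z \<in> bw_vectors"
      using bw_integer_vector_norm[OF z(1,3)] by (simp add: q_def)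
    then show "v \<in> (\<lambda>v. (1 / sqrt 2) *\<^sub>R v) ` bw_vectors"
      by (auto simp: z(2) e_def)
  next
    fix v
    assume "v \<in> (\<lambda>v. (1 / sqrt 2) *\<^sub>R v) ` bw_vectors"
    then obtain z where z: "z \<in> bw_integer_vectors" "v = e z" "q z = 8"
      using bw_vectors_integer by (force simp: e_def q_def)
    moreover from z(3) have "z \<noteq> 0"
      by (auto simp: q_def)
    moreover have "q z \<le> q w" if "w \<in> bw_integer_vectors" "w \<noteq> 0" for w
      using bw_integer_vector_norm[OF that] z(3) by (simp add: q_def)
    ultimately show "v \<in> minimal_vectors barnes_wall_lattice"
      by (auto simp: minimal_vectors_def L e0 norm_le)
  qed
qed

text \<open>A product of coordinates is odd exactly on the intersection of two codeword supports,
  whose size is even. Division by the squared norm 8 turns the even inner products into multiples of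
  1/4.\<close>

lemma bw_vectors_inner:
  assumes "v \<in> bw_vectors" "w \<in> bw_vectors"
  obtains k :: int where "v \<bullet> w = 2 * real_of_int k"
proof -
  obtain z z' where z: "z \<in> bw_integer_vectors" "real_vector_of z = v"
    and z': "z' \<in> bw_integer_vectors" "real_vector_of z' = w"
    using assms bw_vectors_integer by metis
  obtain m s m' s' where m: "m < 16" "m' < 16"
    and parity: "\<And>i. odd (z $ i) \<longleftrightarrow> i \<in> rm_support (m, s)"
      "\<And>i. odd (z' $ i) \<longleftrightarrow> i \<in> rm_support (m', s')"
    using z(1) z'(1) unfolding bw_integer_vectors_def by blast
  have "{i. odd (z $ i * z' $ i)} = rm_support (m, s) \<inter> rm_support (m', s')"
    using parity by auto
  then have "even (card {i \<in> UNIV. odd (z $ i * z' $ i)})"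
    using card_rm_support_Int[OF m, of s s'] by (auto intro: dvd_trans[of 2 4])
  then have "even (\<Sum>i\<in>UNIV. z $ i * z' $ i)"
    by (subst even_sum_iff) auto
  then obtain k where "(\<Sum>i\<in>UNIV. z $ i * z' $ i) = 2 * k"
    by blast
  then have "v \<bullet> w = 2 * real_of_int k"
    unfolding z(2)[symmetric] z'(2)[symmetric] inner_real_vector_of by simp
  then show thesis
    by (rule that)
qed

lemma bw_vectors_norm:
  assumes "v \<in> bw_vectors"
  shows "norm v = sqrt 8"
proof -
  obtain z where z: "real_vector_of z = v" "(\<Sum>i\<in>UNIV. (z $ i)\<^sup>2) = 8"
    using bw_vectors_integer[OF assms] by blast
  have "v \<bullet> v = real_of_int (\<Sum>i\<in>UNIV. (z $ i)\<^sup>2)"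
    unfolding z(1)[symmetric] inner_real_vector_of by (simp add: power2_eq_square)
  then show ?thesis
    unfolding z(2) by (simp add: norm_eq_sqrt_inner)
qed

section \<open>Rescaling to the unit sphere\<close>

lemma C_BW_eq: "C_BW = (\<lambda>v. v /\<^sub>R sqrt 8) ` bw_vectors"
proof -
  have "((1 / sqrt 2) *\<^sub>R v) /\<^sub>R norm ((1 / sqrt 2) *\<^sub>R v) = v /\<^sub>R sqrt 8" if "v \<in> bw_vectors" for v
    using bw_vectors_norm[OF that] by (simp add: inverse_eq_divide)
  then show ?thesis
    unfolding C_BW_def minimal_vectors_barnes_wall_lattice image_image
    by (intro image_cong) auto
qed

lemma finite_bw: "finite bw_vectors"
  by (simp add: bw_vectors_def finite_bw_vectors)

lemma sum_C_BW: "(\<Sum>x\<in>C_BW. f x) = (\<Sum>v\<in>bw_vectors. f (v /\<^sub>R sqrt 8))"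
  unfolding C_BW_eq by (subst sum.reindex) (auto simp: inj_on_def)

lemma card_C_BW: "card C_BW = 4320"
proof -
  have "real (card C_BW) = (\<Sum>x\<in>C_BW. 1)"
    by simp
  also have "\<dots> = 4320"
    unfolding sum_C_BW using sum_bw_vectors_0[of 0] by simp
  finally show ?thesis
    by simp
qed

lemma spherical_code_C_BW: "spherical_code C_BW"
  by (auto simp: spherical_code_def C_BW_eq finite_bw bw_vectors_norm)

text \<open>The intervals that make up each \<open>T\<close> lie strictly between consecutive
  multiples of 1/4, so this integrality gives avoidance.\<close>

lemma C_BW_inner_products:
  assumes "t \<in> inner_products C_BW"
  shows "4 * t \<in> \<int>"
proof -
  obtain v w where vw: "v \<in> bw_vectors" "w \<in> bw_vectors" and t: "t = (v /\<^sub>R sqrt 8) \<bullet> (w /\<^sub>R sqrt 8)"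
    using assms by (auto simp: inner_products_def C_BW_eq)
  obtain k where "v \<bullet> w = 2 * real_of_int k"
    using bw_vectors_inner[OF vw] .
  then have "4 * t = real_of_int k"
    by (simp add: t field_simps flip: real_sqrt_mult)
  then show ?thesis
    by simp
qed

section \<open>Optimality and tightness\<close>

lemma sphere_moment_16:
  "sphere_moment 16 0 = 1" "sphere_moment 16 2 = 1 / 16" "sphere_moment 16 4 = 1 / 96"
  "sphere_moment 16 6 = 1 / 384"
  by (simp_all add: sphere_moment_def lessThan_nat_numeral)

lemma spherical_design_C_BW: "spherical_design 7 C_BW"
proof (rule spherical_designI)
  show "spherical_code C_BW"
    by (rule spherical_code_C_BW)
  show "C_BW \<noteq> {}"
    using card_C_BW by auto
  fix k :: nat and y :: "real ^ 16"
  assume "k \<le> 7"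
  have sum: "(\<Sum>x\<in>C_BW. (x \<bullet> y) ^ k) = (\<Sum>v\<in>bw_vectors. (v \<bullet> y) ^ k) / sqrt 8 ^ k"
    unfolding sum_C_BW sum_divide_distrib
    by (simp add: power_mult_distrib power_inverse divide_inverse mult.commute)
  have norm: "y \<bullet> y = norm y ^ 2" "(y \<bullet> y) ^ 2 = norm y ^ 4" "(y \<bullet> y) ^ 3 = norm y ^ 6"
    by (simp_all add: dot_square_norm flip: power_mult)
  have sqrt: "sqrt 8 ^ 2 = 8" "sqrt 8 ^ 4 = 64" "sqrt 8 ^ 6 = 512"
    using power_mult[of "sqrt 8" 2 2] power_mult[of "sqrt 8" 2 3] by simp_all
  have "odd k \<or> k = 0 \<or> k = 2 \<or> k = 4 \<or> k = 6"
    using \<open>k \<le> 7\<close> by presburger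
  then consider "odd k" | "k = 0" | "k = 2" | "k = 4" | "k = 6"
    by blast
  then show "(\<Sum>x\<in>C_BW. (x \<bullet> y) ^ k) / real (card C_BW) = surface_average (\<lambda>x. (x \<bullet> y) ^ k)"
  proof cases
    case 1
    then show ?thesis
      using \<open>k \<le> 7\<close> by (simp add: sum sum_bw_vectors_odd surface_average_power_odd)
  next
    case 2
    show ?thesis
      unfolding sum surface_average_power card_C_BW unfolding 2 sum_bw_vectors_0
      by (simp add: sphere_moment_16)
  next
    case 3
    show ?thesis
      unfolding sum surface_average_power card_C_BW unfolding 3 sum_bw_vectors_2 norm sqrt
      by (simp add: sphere_moment_16)
  next
    case 4
    show ?thesis
      unfolding sum surface_average_power card_C_BW unfolding 4 sum_bw_vectors_4 norm sqrt
      by (simp add: sphere_moment_16)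
  next
    case 5
    show ?thesis
      unfolding sum surface_average_power card_C_BW unfolding 5 sum_bw_vectors_6 norm sqrt
      by (simp add: sphere_moment_16)
  qed
qed

lemma avoiding_C_BW:
  assumes "\<And>t. t \<in> T \<Longrightarrow> 4 * t \<notin> \<int>"
  shows "avoiding T C_BW"
  using assms C_BW_inner_products by (auto simp: avoiding_def)

lemma four_times_not_Ints:
  assumes "real_of_int k < 4 * t" "4 * t < real_of_int k + 1"
  shows "4 * t \<notin> \<int>"
  using assms by (auto elim!: Ints_cases)

text \<open>The polynomials vanish to first order at the endpoints of the intervals of \<open>T\<close> and at \<open>-1\<close>,
  and to second order at the remaining inner product in \<open>(-1, 1)\<close> of the configuration.\<close>

lemma certificate_1:
  fixes f :: "real poly"
  defines "f \<equiv> [:0, 0, 1/64, 1/64, -5/16, -5/16, 1, 1:]"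
  shows "degree f = 7" "zonal_average 16 f = 1 / 3072" "poly f 1 = 45 / 32"
    "t \<in> {-1..1} - ({-1/2<..<-1/4} \<union> {1/4<..<1/2}) \<Longrightarrow> poly f t \<ge> 0"
proof -
  \<comment> \<open>The ratio of the last two values is 45/32 * 3072 = 4320; the other certificates
    have 135/64 * 2048 and 45/64 * 6144, again 4320.\<close>
  show "degree f = 7" "zonal_average 16 f = 1 / 3072" "poly f 1 = 45 / 32"
    by (simp_all add: f_def zonal_average_def sphere_moment_def atMost_nat_numeral lessThan_nat_numeral)
  assume t: "t \<in> {-1..1} - ({-1/2<..<-1/4} \<union> {1/4<..<1/2})"
  have "poly f t = (t + 1) * t\<^sup>2 * (((t + 1/2) * (t - 1/2)) * ((t + 1/4) * (t - 1/4)))"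
    by (simp add: f_def field_simps power2_eq_square)
  \<comment> \<open>This quartic factor is negative exactly on the two excluded intervals.\<close>
  moreover have "((t + 1/2) * (t - 1/2)) * ((t + 1/4) * (t - 1/4)) \<ge> 0"
    using t by (auto simp: zero_le_mult_iff mult_le_0_iff)
  ultimately show "poly f t \<ge> 0"
    using t by simp
qed

lemma certificate_2:
  fixes f :: "real poly"
  defines "f \<equiv> [:0, 1/128, 3/128, -9/64, -15/32, 3/16, 3/2, 1:]"
  shows "degree f = 7" "zonal_average 16 f = 1 / 2048" "poly f 1 = 135 / 64"
    "t \<in> {-1..1} - ({-1/4<..<0} \<union> {1/4<..<1/2}) \<Longrightarrow> poly f t \<ge> 0"
proof -
  show "degree f = 7" "zonal_average 16 f = 1 / 2048" "poly f 1 = 135 / 64"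
    by (simp_all add: f_def zonal_average_def sphere_moment_def atMost_nat_numeral lessThan_nat_numeral)
  assume t: "t \<in> {-1..1} - ({-1/4<..<0} \<union> {1/4<..<1/2})"
  have "poly f t = (t + 1) * (t + 1/2)\<^sup>2 * (((t + 1/4) * t) * ((t - 1/4) * (t - 1/2)))"
    by (simp add: f_def field_simps power2_eq_square)
  moreover have "((t + 1/4) * t) * ((t - 1/4) * (t - 1/2)) \<ge> 0"
    using t by (auto simp: zero_le_mult_iff mult_le_0_iff)
  ultimately show "poly f t \<ge> 0"
    using t by simp
qed

lemma certificate_3:
  fixes f :: "real poly"
  defines "f \<equiv> [:0, -1/128, 1/128, 11/64, -5/32, -13/16, 1/2, 1:]"
  shows "degree f = 7" "zonal_average 16 f = 1 / 6144" "poly f 1 = 45 / 64"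
    "t \<in> {-1..1} - ({-1/2<..<-1/4} \<union> {0<..<1/4}) \<Longrightarrow> poly f t \<ge> 0"
proof -
  show "degree f = 7" "zonal_average 16 f = 1 / 6144" "poly f 1 = 45 / 64"
    by (simp_all add: f_def zonal_average_def sphere_moment_def atMost_nat_numeral lessThan_nat_numeral)
  assume t: "t \<in> {-1..1} - ({-1/2<..<-1/4} \<union> {0<..<1/4})"
  have "poly f t = (t + 1) * (t - 1/2)\<^sup>2 * (((t + 1/2) * (t + 1/4)) * (t * (t - 1/4)))"
    by (simp add: f_def field_simps power2_eq_square)
  moreover have "((t + 1/2) * (t + 1/4)) * (t * (t - 1/4)) \<ge> 0"
    using t by (auto simp: zero_le_mult_iff mult_le_0_iff)
  ultimately show "poly f t \<ge> 0"
    using t by simp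
qed

text \<open>The same \<open>f\<close> serves twice: as a lower bound for every competing design,
  attained by \<open>C_BW\<close>, and as the witness of tightness, where the coefficients of index
  above 7 vanish because \<open>degree f = 7\<close>.\<close>

lemma optimal_and_tight:
  assumes avoiding: "avoiding T C_BW"
    and f: "degree f = 7" "zonal_average 16 f > 0" "poly f 1 = 4320 * zonal_average 16 f"
      "\<And>t. t \<in> {-1..1} - T \<Longrightarrow> poly f t \<ge> 0"
  shows "min_design_size TYPE(16) 7 T = 4320 \<and> tight_avoiding_design 7 T C_BW"
proof
  have "4320 \<le> card C" if C: "spherical_design 7 C" "avoiding T C" for C :: "(real ^ 16) set"
  proof -
    have "4320 * zonal_average 16 f \<le> zonal_average 16 f * real (card C)"
      using linear_programming_bound[OF C, of f] f by simp
    then show ?thesis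
      using f(2) by simp
  qed
  then show "min_design_size TYPE(16) 7 T = 4320"
    unfolding min_design_size_def
    by (intro cInf_eq_minimum)
       (auto intro!: exI[of _ C_BW] simp: card_C_BW spherical_design_C_BW avoiding)
  obtain c where c: "gegenbauer_expansion 16 f c" "c 0 = zonal_average 16 f"
    by (rule gegenbauer_expansion_exists[of 16 f]) simp
  have "c i \<le> 0" if "i \<ge> 7 + 1" for i
    using c(1) f(1) that by (auto simp: gegenbauer_expansion_def)
  then show "tight_avoiding_design 7 T C_BW"
    unfolding tight_avoiding_design_def using c f
    by (auto simp: spherical_design_C_BW avoiding card_C_BW intro!: exI[of _ f] exI[of _ c])
qed

theorem theorem6p7:
  fixes T :: "real set"
  assumes "T \<in> {{-1/2<..<-1/4} \<union> {1/4<..<1/2},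
                 {-1/4<..<0} \<union> {1/4<..<1/2},
                 {-1/2<..<-1/4} \<union> {0<..<1/4}}"
  shows "min_design_size TYPE(16) 7 T = 4320 \<and> tight_avoiding_design 7 T C_BW"
proof -
  have avoiding: "avoiding T C_BW"
  proof (rule avoiding_C_BW)
    fix t
    assume "t \<in> T"
    then consider "t \<in> {-1/2<..<-1/4}" | "t \<in> {-1/4<..<0}" | "t \<in> {0<..<1/4}" | "t \<in> {1/4<..<1/2}"
      using assms by blast
    then show "4 * t \<notin> \<int>"
      using four_times_not_Ints[of "- 2" t] four_times_not_Ints[of "- 1" t]
        four_times_not_Ints[of 0 t] four_times_not_Ints[of 1 t]
      by cases auto
  qed
  from assms consider "T = {-1/2<..<-1/4} \<union> {1/4<..<1/2}" | "T = {-1/4<..<0} \<union> {1/4<..<1/2}"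
    | "T = {-1/2<..<-1/4} \<union> {0<..<1/4}"
    by blast
  then show ?thesis
  proof cases
    case 1
    show ?thesis
      by (rule optimal_and_tight[OF avoiding certificate_1(1)])
         (use certificate_1 1 in auto)
  next
    case 2
    show ?thesis
      by (rule optimal_and_tight[OF avoiding certificate_2(1)])
         (use certificate_2 2 in auto)
  next
    case 3
    show ?thesis
      by (rule optimal_and_tight[OF avoiding certificate_3(1)])
         (use certificate_3 3 in auto)
  qed
qed

end
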